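(* Let $p\ge 1$. Suppose that $f:\mathbb R\to\mathbb R$ is Lipschitz continuous with $\|f\|_{\mathrm{Lip}}:=\sup_{u\ne v}\frac{|f(u)-f(v)|}{|u-v|}<\gamma$, where $\gamma>0$ is the constant in the Poincaré inequality $\|\nabla v\|^2\ge\gamma\|v\|^2$ for all $v\in\mathbb H^1_0$. Suppose also that there is a constant $\beta\in[0,2]$ such that $\|A^{\frac{\beta-2}{2}}\|_{\mathcal L_2^0}<\infty$. Then the elliptic SPDE $$-\Delta u=f(u)+\dot W^Q\ \text{ in }\mathscr O,\qquad u=0\ \text{ on }\partial\mathscr O,$$ possesses a unique (mild) solution $u\in L^p(\Omega;\dot{\mathbb H}^\beta)$.
   Context: $(\Omega,\mathscr F,\mathbb P)$ is a probability space and $\mathscr O\subset\mathbb R^d$ is a bounded open domain with regular (piecewise smooth) boundary $\partial\mathscr O$. $\mathbb H=L^2(\mathscr O)$ with inner product $(\cdot,\cdot)$ and norm $\|\cdot\|$. $\mathbb H^r$ ($r\in\mathbb N$) is the usual Sobolev space on $\mathscr O$ of functions with square integrable derivatives up to order $r$. $\mathbb H^1_0$ is the subspace of $\mathbb H^1$ of functions vanishing on $\partial\mathscr O$. $A=-\Delta$ is the negative Dirichlet Laplacian, with eigenvalues $0<\lambda_1\le\lambda_2\le\cdots$ (of finite multiplicity, in ascending order) and eigenvectors $\varphi_k$, $A\varphi_k=\lambda_k\varphi_k$, forming a complete orthonormal basis of $L^2(\mathscr O)$. For $s\in\mathbb R$, $\dot{\mathbb H}^s=\{v:\ \|v\|_s:=(\sum_{k\ge1}\lambda_k^s(v,\varphi_k)^2)^{1/2}<\infty\}$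 (for $s<0$, understood as formal series in the $\varphi_k$, i.e. the dual of $\dot{\mathbb H}^{-s}$). Powers of $A$ act by $A^{s}\varphi_k=\lambda_k^{s}\varphi_k$; in particular $A^{-1}:\dot{\mathbb H}^{s}\to\dot{\mathbb H}^{s+2}$. Noise: $Q$ is the (nonnegative, self-adjoint) covariance operator with eigensystem $Q\psi_m=\sigma_m\psi_m$, $m\ge1$, where $\{\psi_m\}$ is a complete orthonormal basis of $\mathbb H$ (not assumed related to $\{\varphi_k\}$). The centered Gaussian noise is $\dot W^Q=\sum_{m=1}^\infty Q^{1/2}\psi_m\,\eta_m$ with $\{\eta_m\}$ independent standard normal random variables. $\mathcal L_2^0$ is the space of Hilbert–Schmidt operators from $Q^{1/2}(\mathbb H)$ to $\mathbb H$, so $\|T\|_{\mathcal L_2^0}^2=\sum_{k}\|TQ^{1/2}\psi_k\|^2$. When $\|A^{(\beta-2)/2}\|_{\mathcal L_2^0}<\infty$, the series for $\dot W^Q$ converges in $L^2(\Omega;\dot{\mathbb H}^{\beta-2})$. Mild solution: an $\mathbb H$-valued random field $u$ is a (mild) solution if $u=A^{-1}f(u)+A^{-1}\dot W^Q$ almost surely, where $f(u)$ denotes the function $x\mapsto f(u(x))$. *)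

theory Defs
  imports "HOL-Probability.Probability"
begin

text \<open>
  \<open>Ck_on n f U\<close> is meant for open \<open>U\<close>: all iterated partial derivatives of \<open>f\<close> of order at
  most \<open>n\<close> exist and are continuous on \<open>U\<close>.
\<close>

primrec Ck_on ::
  "nat \<Rightarrow> ('a::euclidean_space \<Rightarrow> 'b::euclidean_space) \<Rightarrow> 'a set \<Rightarrow> bool" where
  "Ck_on 0 f U \<longleftrightarrow> continuous_on U f"
| "Ck_on (Suc n) f U \<longleftrightarrow>
     (\<forall>x\<in>U. f differentiable (at x)) \<and>
     (\<forall>i\<in>Basis. Ck_on n (\<lambda>x. frechet_derivative f (at x) i) U)"

definition smooth_on :: "('a::euclidean_space \<Rightarrow> 'b::euclidean_space) \<Rightarrow> 'a set \<Rightarrow> bool" where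
  "smooth_on f U \<longleftrightarrow> (\<forall>n. Ck_on n f U)"

text \<open>
  A smooth face is a smoothly embedded (curved) polytope of codimension one: the image of a flat
  one under a smooth diffeomorphism defined on a neighbourhood of it.  A bounded set has a
  piecewise smooth boundary if its frontier is a finite union of smooth faces.  Corners, edges
  and re-entrant angles are allowed.
\<close>

definition smooth_face :: "'a::euclidean_space set \<Rightarrow> bool" where
  "smooth_face S \<longleftrightarrow>
     (\<exists>K U (F :: 'a \<Rightarrow> 'a). polytope K \<and> aff_dim K = int DIM('a) - 1 \<and>
        open U \<and> K \<subseteq> U \<and> smooth_on F U \<and> inj_on F U \<and>
        (\<forall>x\<in>U. bij (frechet_derivative F (at x))) \<and> S = F ` K)"

definition piecewise_smooth_boundary :: "'a::euclidean_space set \<Rightarrow> bool" where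
  "piecewise_smooth_boundary D \<longleftrightarrow>
     (\<exists>\<S>. finite \<S> \<and> (\<forall>S\<in>\<S>. smooth_face S) \<and> frontier D = \<Union>\<S>)"

text \<open>
  Elements of \<open>L\<^sup>2(D)\<close> are represented by functions; equality in \<open>L\<^sup>2(D)\<close> is equality almost
  everywhere with respect to \<open>lebesgue_on D\<close>.
\<close>

definition L2 :: "'a::euclidean_space set \<Rightarrow> ('a \<Rightarrow> real) set" where
  "L2 D = {v. v \<in> borel_measurable (lebesgue_on D) \<and>
              integrable (lebesgue_on D) (\<lambda>x. (v x)\<^sup>2)}"

definition L2_inner :: "'a::euclidean_space set \<Rightarrow> ('a \<Rightarrow> real) \<Rightarrow> ('a \<Rightarrow> real) \<Rightarrow> real" where
  "L2_inner D v w = (LINT x|lebesgue_on D. v x * w x)"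

definition L2_norm :: "'a::euclidean_space set \<Rightarrow> ('a \<Rightarrow> real) \<Rightarrow> real" where
  "L2_norm D v = sqrt (L2_inner D v v)"

definition L2_orthonormal_basis ::
  "'a::euclidean_space set \<Rightarrow> (nat \<Rightarrow> 'a \<Rightarrow> real) \<Rightarrow> bool" where
  "L2_orthonormal_basis D e \<longleftrightarrow>
     (\<forall>k. e k \<in> L2 D) \<and>
     (\<forall>j k. L2_inner D (e j) (e k) = (if j = k then 1 else 0)) \<and>
     (\<forall>v\<in>L2 D. (\<lambda>n. L2_norm D (\<lambda>x. v x - (\<Sum>k<n. L2_inner D v (e k) * e k x))) \<longlonglongrightarrow> 0)"

text \<open>
  Nonnegative self-adjoint operators defined on all of \<open>L\<^sup>2(D)\<close> (hence bounded, by
  Hellinger--Toeplitz).  Symmetry forces such an operator to respect equality almost everywhere.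
\<close>

definition L2_nonneg_selfadjoint ::
  "'a::euclidean_space set \<Rightarrow> (('a \<Rightarrow> real) \<Rightarrow> ('a \<Rightarrow> real)) \<Rightarrow> bool" where
  "L2_nonneg_selfadjoint D T \<longleftrightarrow>
     (\<forall>v\<in>L2 D. T v \<in> L2 D) \<and>
     (\<forall>v\<in>L2 D. \<forall>w\<in>L2 D. \<forall>a b.
        AE x in lebesgue_on D. T (\<lambda>y. a * v y + b * w y) x = a * T v x + b * T w x) \<and>
     (\<forall>v\<in>L2 D. \<forall>w\<in>L2 D. L2_inner D (T v) w = L2_inner D v (T w)) \<and>
     (\<forall>v\<in>L2 D. L2_inner D (T v) v \<ge> 0)"

definition L2_operator_sqrt ::
  "'a::euclidean_space set \<Rightarrow> (('a \<Rightarrow> real) \<Rightarrow> ('a \<Rightarrow> real)) \<Rightarrow>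
   (('a \<Rightarrow> real) \<Rightarrow> ('a \<Rightarrow> real)) \<Rightarrow> bool" where
  "L2_operator_sqrt D Q R \<longleftrightarrow>
     L2_nonneg_selfadjoint D R \<and>
     (\<forall>v\<in>L2 D. AE x in lebesgue_on D. R (R v) x = Q v x)"

definition test_functions :: "'a::euclidean_space set \<Rightarrow> ('a \<Rightarrow> real) set" where
  "test_functions D =
     {w. smooth_on w UNIV \<and> compact (closure {x. w x \<noteq> 0}) \<and> closure {x. w x \<noteq> 0} \<subseteq> D}"

definition is_weak_gradient ::
  "'a::euclidean_space set \<Rightarrow> ('a \<Rightarrow> real) \<Rightarrow> ('a \<Rightarrow> 'a) \<Rightarrow> bool" where
  "is_weak_gradient D v G \<longleftrightarrow>
     G \<in> borel_measurable (lebesgue_on D) \<and>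
     integrable (lebesgue_on D) (\<lambda>x. (norm (G x))\<^sup>2) \<and>
     (\<forall>w\<in>test_functions D. \<forall>i\<in>Basis.
        L2_inner D v (\<lambda>x. frechet_derivative w (at x) i) = - L2_inner D (\<lambda>x. G x \<bullet> i) w)"

definition H1 :: "'a::euclidean_space set \<Rightarrow> ('a \<Rightarrow> real) set" where
  "H1 D = {v \<in> L2 D. \<exists>G. is_weak_gradient D v G}"

text \<open>The weak gradient is determined up to null sets; one representative is selected.\<close>

definition weak_gradient :: "'a::euclidean_space set \<Rightarrow> ('a \<Rightarrow> real) \<Rightarrow> 'a \<Rightarrow> 'a" where
  "weak_gradient D v = (SOME G. is_weak_gradient D v G)"

definition grad_inner :: "'a::euclidean_space set \<Rightarrow> ('a \<Rightarrow> real) \<Rightarrow> ('a \<Rightarrow> real) \<Rightarrow> real" where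
  "grad_inner D v w = (LINT x|lebesgue_on D. weak_gradient D v x \<bullet> weak_gradient D w x)"

definition H1_norm :: "'a::euclidean_space set \<Rightarrow> ('a \<Rightarrow> real) \<Rightarrow> real" where
  "H1_norm D v = sqrt (L2_inner D v v + grad_inner D v v)"

text \<open>Vanishing on the boundary is understood as membership in the \<open>H\<^sup>1\<close>-closure of the test functions.\<close>

definition H10 :: "'a::euclidean_space set \<Rightarrow> ('a \<Rightarrow> real) set" where
  "H10 D = {v \<in> H1 D. \<exists>w. (\<forall>n. w n \<in> test_functions D) \<and>
                            (\<lambda>n. H1_norm D (\<lambda>x. w n x - v x)) \<longlonglongrightarrow> 0}"

text \<open>
  \<open>neg_dirichlet_laplacian D v g\<close> says that \<open>v\<close> lies in the domain of \<open>A = -\<Delta>\<close> and \<open>A v = g\<close>,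
  with the Laplacian in weak (variational) form.
\<close>

definition neg_dirichlet_laplacian ::
  "'a::euclidean_space set \<Rightarrow> ('a \<Rightarrow> real) \<Rightarrow> ('a \<Rightarrow> real) \<Rightarrow> bool" where
  "neg_dirichlet_laplacian D v g \<longleftrightarrow>
     v \<in> H10 D \<and> g \<in> L2 D \<and> (\<forall>w\<in>H10 D. grad_inner D v w = L2_inner D g w)"

text \<open>Indices start at \<open>0\<close>, so \<open>lam k\<close> is the eigenvalue usually called \<open>\<lambda>\<^bsub>k+1\<^esub>\<close>.\<close>

definition dirichlet_eigensystem ::
  "'a::euclidean_space set \<Rightarrow> (nat \<Rightarrow> real) \<Rightarrow> (nat \<Rightarrow> 'a \<Rightarrow> real) \<Rightarrow> bool" where
  "dirichlet_eigensystem D lam phi \<longleftrightarrow>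
     L2_orthonormal_basis D phi \<and>
     (\<forall>k. neg_dirichlet_laplacian D (phi k) (\<lambda>x. lam k * phi k x)) \<and>
     lam 0 > 0 \<and> incseq lam \<and> (\<forall>c. finite {k. lam k = c})"

text \<open>
  Formal series \<open>\<Sum>\<^sub>k c\<^sub>k \<phi>\<^sub>k\<close> are represented by their coefficient sequences \<open>c\<close>, and a function
  \<open>v\<close> in \<open>L\<^sup>2(D)\<close> is identified with the series with coefficients \<open>(v, \<phi>\<^sub>k)\<close>.
\<close>

definition fourier ::
  "'a::euclidean_space set \<Rightarrow> (nat \<Rightarrow> 'a \<Rightarrow> real) \<Rightarrow> ('a \<Rightarrow> real) \<Rightarrow> nat \<Rightarrow> real" where
  "fourier D phi v = (\<lambda>k. L2_inner D v (phi k))"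

definition Hdot :: "(nat \<Rightarrow> real) \<Rightarrow> real \<Rightarrow> (nat \<Rightarrow> real) set" where
  "Hdot lam s = {c. summable (\<lambda>k. lam k powr s * (c k)\<^sup>2)}"

definition Hdot_norm :: "(nat \<Rightarrow> real) \<Rightarrow> real \<Rightarrow> (nat \<Rightarrow> real) \<Rightarrow> real" where
  "Hdot_norm lam s c = sqrt (\<Sum>k. lam k powr s * (c k)\<^sup>2)"

definition A_pow :: "(nat \<Rightarrow> real) \<Rightarrow> real \<Rightarrow> (nat \<Rightarrow> real) \<Rightarrow> nat \<Rightarrow> real" where
  "A_pow lam s c = (\<lambda>k. lam k powr s * c k)"

text \<open>
  Borel sigma-algebra of a set \<open>S\<close> with pseudometric \<open>d\<close>.  (Distinct representatives of one element
  of \<open>L\<^sup>2(D)\<close> have distance \<open>0\<close>, so \<open>L\<^sup>2(D)\<close> is only a pseudometric space here.)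
\<close>

definition metric_borel :: "'b set \<Rightarrow> ('b \<Rightarrow> 'b \<Rightarrow> real) \<Rightarrow> 'b measure" where
  "metric_borel S d = sigma S {U. U \<subseteq> S \<and> (\<forall>x\<in>U. \<exists>e>0. \<forall>y\<in>S. d x y < e \<longrightarrow> y \<in> U)}"

definition L2_borel :: "'a::euclidean_space set \<Rightarrow> ('a \<Rightarrow> real) measure" where
  "L2_borel D = metric_borel (L2 D) (\<lambda>v w. L2_norm D (\<lambda>x. v x - w x))"

definition Hdot_borel :: "(nat \<Rightarrow> real) \<Rightarrow> real \<Rightarrow> (nat \<Rightarrow> real) measure" where
  "Hdot_borel lam s = metric_borel (Hdot lam s) (\<lambda>b c. Hdot_norm lam s (\<lambda>k. b k - c k))"

definition Lp_Hdot ::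
  "'w measure \<Rightarrow> real \<Rightarrow> (nat \<Rightarrow> real) \<Rightarrow> real \<Rightarrow> ('w \<Rightarrow> nat \<Rightarrow> real) set" where
  "Lp_Hdot M p lam s =
     {X. X \<in> measurable M (Hdot_borel lam s) \<and>
         integrable M (\<lambda>\<omega>. Hdot_norm lam s (X \<omega>) powr p)}"

text \<open>
  \<open>\<Sum>\<^sub>m \<parallel>T Q\<^sup>1\<^sup>/\<^sup>2 \<psi>\<^sub>m\<parallel>\<^sup>2\<close> for an operator \<open>T\<close> acting on formal series, with \<open>Qh = Q\<^sup>1\<^sup>/\<^sup>2\<close>.  The inner sum is
  the squared \<open>L\<^sup>2(D)\<close>-norm by Parseval; it is infinite if the series is not in \<open>L\<^sup>2(D)\<close>.
\<close>

definition L20_norm_sq ::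
  "'a::euclidean_space set \<Rightarrow> (nat \<Rightarrow> 'a \<Rightarrow> real) \<Rightarrow> (('a \<Rightarrow> real) \<Rightarrow> ('a \<Rightarrow> real)) \<Rightarrow>
   (nat \<Rightarrow> 'a \<Rightarrow> real) \<Rightarrow> ((nat \<Rightarrow> real) \<Rightarrow> (nat \<Rightarrow> real)) \<Rightarrow> ennreal" where
  "L20_norm_sq D phi Qh psi T =
     (\<Sum>m. \<Sum>k. ennreal ((T (fourier D phi (Qh (psi m))) k)\<^sup>2))"

definition is_noise ::
  "'w measure \<Rightarrow> 'a::euclidean_space set \<Rightarrow> (nat \<Rightarrow> real) \<Rightarrow> (nat \<Rightarrow> 'a \<Rightarrow> real) \<Rightarrow>
   (('a \<Rightarrow> real) \<Rightarrow> ('a \<Rightarrow> real)) \<Rightarrow> (nat \<Rightarrow> 'a \<Rightarrow> real) \<Rightarrow> (nat \<Rightarrow> 'w \<Rightarrow> real) \<Rightarrow> real \<Rightarrow>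
   ('w \<Rightarrow> nat \<Rightarrow> real) \<Rightarrow> bool" where
  "is_noise M D lam phi Qh psi eta s W \<longleftrightarrow>
     W \<in> Lp_Hdot M 2 lam s \<and>
     (\<lambda>n. \<integral>\<^sup>+ \<omega>. ennreal ((Hdot_norm lam s
            (\<lambda>k. (\<Sum>m<n. fourier D phi (Qh (psi m)) k * eta m \<omega>) - W \<omega> k))\<^sup>2) \<partial>M) \<longlonglongrightarrow> 0"

definition Lip_norm :: "(real \<Rightarrow> real) \<Rightarrow> real" where
  "Lip_norm f = Sup {\<bar>f u - f v\<bar> / \<bar>u - v\<bar> | u v. u \<noteq> v}"

definition mild_solution ::
  "'w measure \<Rightarrow> 'a::euclidean_space set \<Rightarrow> (nat \<Rightarrow> real) \<Rightarrow> (nat \<Rightarrow> 'a \<Rightarrow> real) \<Rightarrow>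
   (real \<Rightarrow> real) \<Rightarrow> ('w \<Rightarrow> nat \<Rightarrow> real) \<Rightarrow> ('w \<Rightarrow> 'a \<Rightarrow> real) \<Rightarrow> bool" where
  "mild_solution M D lam phi f W u \<longleftrightarrow>
     u \<in> measurable M (L2_borel D) \<and>
     (AE \<omega> in M. fourier D phi (u \<omega>) =
        (\<lambda>k. A_pow lam (-1) (fourier D phi (\<lambda>x. f (u \<omega> x))) k + A_pow lam (-1) (W \<omega>) k))"

end

theory Submission
  imports Defs
begin

text \<open>
  The equation is solved one noise realisation at a time.  For a fixed
  \<open>w\<close> in \<open>Hdot lam (\<beta> - 2)\<close>, a solution of \<open>u = A\<^sup>-\<^sup>1 f(u) + A\<^sup>-\<^sup>1 w\<close> is a fixed point, and its right-hand side
  contracts \<open>L\<^sup>2(D)\<close>: testing the Poincare inequality on \<open>\<phi>\<^sub>k\<close> gives \<open>\<gamma> \<le> \<lambda>\<^sub>k\<close>, so \<open>A\<^sup>-\<^sup>1\<close> has norm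
  at most \<open>1 / \<gamma>\<close> and the contraction factor is at most the Lipschitz constant of \<open>f\<close> divided by
  \<open>\<gamma>\<close>, which is less than \<open>1\<close> (\<open>eigenvalue_ge_poincare\<close>, \<open>solution_exists\<close>).  Functions in \<open>L\<^sup>2(D)\<close>
  are only representatives, so the fixed point is found among square summable coefficient
  sequences, which form a genuine complete metric space; the Riesz--Fischer theorem
  (\<open>riesz_fischer\<close>) and Parseval's identity (\<open>parseval\<close>) translate between the two.

  The same contraction estimate compares the solutions for two noises and shows that the solution
  operator \<open>w \<mapsto> u\<close> is Lipschitz continuous, both into \<open>L\<^sup>2(D)\<close> and, because \<open>A\<^sup>-\<^sup>1\<close> gains two orders of
  regularity, into \<open>Hdot lam \<beta>\<close> (\<open>solves_stable_L2\<close>, \<open>solves_stable_Hdot\<close>).  Pathwise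
  uniqueness, measurability of the random field \<open>u\<close>, and a bound of \<open>\<parallel>u\<parallel>\<^sub>\<beta>\<close> that is affine in
  \<open>\<parallel>w\<parallel>\<^sub>\<beta>\<^sub>-\<^sub>2\<close> all follow from it.

  It remains to know that the noise has moments of every order, although it is given only as a
  limit in mean square (\<open>gaussian_series_even_moments\<close>).  Each coefficient \<open>W\<^sub>k\<close> is a mean-square limit
  of finite Gaussian sums, so its moment of order \<open>2n\<close> is at most the standard normal one times
  \<open>v\<^sub>k\<^sup>n\<close>, where \<open>v\<^sub>k\<close> is the sum of the squares of the factors of the \<open>\<eta>\<^sub>m\<close> in \<open>W\<^sub>k\<close>.  The Hilbert--Schmidt condition
  says that \<open>\<Sum>\<^sub>k \<lambda>\<^sub>k\<^sup>\<beta>\<^sup>-\<^sup>2 v\<^sub>k\<close> is finite, and Jensen's inequality with the weights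
  \<open>\<lambda>\<^sub>k\<^sup>\<beta>\<^sup>-\<^sup>2 v\<^sub>k\<close> turns the coordinatewise bounds into a bound on \<open>E \<parallel>W\<parallel>\<^sup>2\<^sup>n\<close>.
\<close>

section \<open>Square integrable functions\<close>

lemma L2_measurable: "v \<in> L2 D \<Longrightarrow> v \<in> borel_measurable (lebesgue_on D)"
  by (simp add: L2_def)

lemma L2_square_integrable: "v \<in> L2 D \<Longrightarrow> integrable (lebesgue_on D) (\<lambda>x. (v x)\<^sup>2)"
  by (simp add: L2_def)

lemma L2_mult_integrable:
  assumes "v \<in> L2 D" "w \<in> L2 D"
  shows "integrable (lebesgue_on D) (\<lambda>x. v x * w x)"
proof (rule Bochner_Integration.integrable_bound)
  show "integrable (lebesgue_on D) (\<lambda>x. (v x)\<^sup>2 + (w x)\<^sup>2)"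
    using assms by (simp add: L2_def)
  show "(\<lambda>x. v x * w x) \<in> borel_measurable (lebesgue_on D)"
    by (intro borel_measurable_times L2_measurable assms)
  have "\<bar>a * b\<bar> \<le> a\<^sup>2 + b\<^sup>2" for a b :: real
    using sum_squares_bound[of "\<bar>a\<bar>" "\<bar>b\<bar>"] mult_nonneg_nonneg[of "\<bar>a\<bar>" "\<bar>b\<bar>"]
    by (simp only: abs_mult power2_abs) linarith
  then show "AE x in lebesgue_on D. norm (v x * w x) \<le> norm ((v x)\<^sup>2 + (w x)\<^sup>2)"
    by simp
qed

lemma L2_lincomb:
  assumes "v \<in> L2 D" "w \<in> L2 D"
  shows "(\<lambda>x. a * v x + b * w x) \<in> L2 D"
proof -
  have "(\<lambda>x. (a * v x + b * w x)\<^sup>2) = (\<lambda>x. a\<^sup>2 * (v x)\<^sup>2 + b\<^sup>2 * (w x)\<^sup>2 + 2 * a * b * (v x * w x))"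
    by (auto simp: power2_eq_square algebra_simps)
  then show ?thesis
    using assms L2_mult_integrable[OF assms]
    by (auto simp: L2_def intro!: borel_measurable_add borel_measurable_times)
qed

lemma L2_diff: "v \<in> L2 D \<Longrightarrow> w \<in> L2 D \<Longrightarrow> (\<lambda>x. v x - w x) \<in> L2 D"
  using L2_lincomb[of v D w 1 "-1"] by simp

lemma L2_sum:
  assumes "\<And>k. e k \<in> L2 D"
  shows "(\<lambda>x. \<Sum>k\<in>I. c k * e k x) \<in> L2 D"
proof (cases "finite I")
  case True
  then show ?thesis
  proof (induction I)
    case empty
    then show ?case by (simp add: L2_def)
  next
    case (insert k I)
    then show ?case
      using L2_lincomb[OF assms insert.IH, of "c k" k 1] by simp
  qed
qed (simp add: L2_def)

lemma L2_inner_commute: "L2_inner D v w = L2_inner D w v"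
  by (simp add: L2_inner_def mult.commute)

lemma L2_inner_lincomb_left:
  assumes "u \<in> L2 D" "v \<in> L2 D" "w \<in> L2 D"
  shows "L2_inner D (\<lambda>x. a * u x + b * v x) w = a * L2_inner D u w + b * L2_inner D v w"
  using L2_mult_integrable[OF assms(1,3)] L2_mult_integrable[OF assms(2,3)]
  by (simp add: L2_inner_def algebra_simps)

lemma L2_inner_diff_left:
  assumes "u \<in> L2 D" "v \<in> L2 D" "w \<in> L2 D"
  shows "L2_inner D (\<lambda>x. u x - v x) w = L2_inner D u w - L2_inner D v w"
  using L2_inner_lincomb_left[OF assms, of 1 "-1"] by simp

lemma L2_inner_self_nonneg: "L2_inner D v v \<ge> 0"
  unfolding L2_inner_def by (rule Bochner_Integration.integral_nonneg) simp

lemma L2_norm_power2: "(L2_norm D v)\<^sup>2 = L2_inner D v v"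
  by (simp add: L2_norm_def L2_inner_self_nonneg)

lemma L2_norm_nonneg: "L2_norm D v \<ge> 0"
  by (simp add: L2_norm_def L2_inner_self_nonneg)

lemma L2_norm_eq_0_AE:
  assumes "v \<in> L2 D" "L2_norm D v = 0"
  shows "AE x in lebesgue_on D. v x = 0"
proof -
  have "(\<integral>x. (v x)\<^sup>2 \<partial>lebesgue_on D) = 0"
    using assms(2) L2_norm_power2[of D v] by (simp add: L2_inner_def power2_eq_square)
  then have "AE x in lebesgue_on D. (v x)\<^sup>2 = 0"
    using integral_nonneg_eq_0_iff_AE[OF L2_square_integrable[OF assms(1)]] by simp
  then show ?thesis by simp
qed

lemma L2_inner_lincomb_self:
  assumes "v \<in> L2 D" "w \<in> L2 D"
  shows "L2_inner D (\<lambda>x. a * v x + b * w x) (\<lambda>x. a * v x + b * w x) =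
         a\<^sup>2 * L2_inner D v v + b\<^sup>2 * L2_inner D w w + 2 * a * b * L2_inner D v w"
proof -
  have m: "(\<lambda>x. a * v x + b * w x) \<in> L2 D" by (rule L2_lincomb[OF assms])
  have "L2_inner D (\<lambda>x. a * v x + b * w x) (\<lambda>x. a * v x + b * w x) =
        a * L2_inner D (\<lambda>x. a * v x + b * w x) v + b * L2_inner D (\<lambda>x. a * v x + b * w x) w"
    by (simp add: L2_inner_lincomb_left[OF assms m] L2_inner_commute[of D v] L2_inner_commute[of D w])
  then show ?thesis
    by (simp add: L2_inner_lincomb_left assms L2_inner_commute[of D w v])
      (simp add: power2_eq_square algebra_simps)
qed

lemma L2_Cauchy_Schwarz:
  assumes "v \<in> L2 D" "w \<in> L2 D"
  shows "\<bar>L2_inner D v w\<bar> \<le> L2_norm D v * L2_norm D w"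
proof (cases "L2_norm D v = 0 \<or> L2_norm D w = 0")
  case True
  then have "AE x in lebesgue_on D. v x * w x = 0"
    using L2_norm_eq_0_AE[OF assms(1)] L2_norm_eq_0_AE[OF assms(2)] by (auto elim: eventually_mono)
  then have "L2_inner D v w = 0"
    unfolding L2_inner_def by (rule integral_eq_zero_AE)
  then show ?thesis by (simp add: L2_norm_nonneg)
next
  case False
  define p where "p = L2_norm D v"
  define q where "q = L2_norm D w"
  have pq: "p * q > 0"
    using False L2_norm_nonneg[of D v] L2_norm_nonneg[of D w] by (auto simp: p_def q_def less_le)
  \<comment> \<open>Expand \<open>\<parallel>q v + s p w\<parallel>\<^sup>2 \<ge> 0\<close> and take \<open>s = \<plusminus>1\<close>.\<close>
  have "0 \<le> q\<^sup>2 * p\<^sup>2 + (s * p)\<^sup>2 * q\<^sup>2 + 2 * q * (s * p) * L2_inner D v w" for s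
    using L2_inner_self_nonneg[of D "\<lambda>x. q * v x + (s * p) * w x"]
    by (simp only: L2_inner_lincomb_self[OF assms] p_def q_def L2_norm_power2)
  from this[of 1] this[of "-1"]
  have "0 \<le> (p * q) * (p * q + L2_inner D v w)" "0 \<le> (p * q) * (p * q - L2_inner D v w)"
    by (simp_all add: power2_eq_square algebra_simps)
  then show ?thesis
    using pq by (simp add: zero_le_mult_iff p_def q_def abs_le_iff)
qed

lemma orthonormal_basis_in_L2: "L2_orthonormal_basis D e \<Longrightarrow> e k \<in> L2 D"
  by (simp add: L2_orthonormal_basis_def)

lemma L2_inner_sum_left:
  assumes "\<And>k. e k \<in> L2 D" "w \<in> L2 D"
  shows "L2_inner D (\<lambda>x. \<Sum>k\<in>I. c k * e k x) w = (\<Sum>k\<in>I. c k * L2_inner D (e k) w)"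
proof -
  have "(\<lambda>x. (\<Sum>k\<in>I. c k * e k x) * w x) = (\<lambda>x. \<Sum>k\<in>I. c k * (e k x * w x))"
    by (simp add: sum_distrib_right mult.assoc)
  then show ?thesis
    using L2_mult_integrable[OF assms] by (simp add: L2_inner_def)
qed

lemma L2_inner_sum_orthonormal:
  assumes e: "L2_orthonormal_basis D e" and "finite I"
  shows "L2_inner D (\<lambda>x. \<Sum>k\<in>I. c k * e k x) (e j) = (if j \<in> I then c j else 0)"
proof -
  have "L2_inner D (\<lambda>x. \<Sum>k\<in>I. c k * e k x) (e j) = (\<Sum>k\<in>I. c k * (if k = j then 1 else 0))"
    using e by (subst L2_inner_sum_left) (auto simp: L2_orthonormal_basis_def)
  also have "\<dots> = (if j \<in> I then c j else 0)"
    using \<open>finite I\<close> by (simp add: if_distrib sum.If_cases cong: if_cong)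
  finally show ?thesis .
qed

lemma L2_norm_sum_orthonormal:
  assumes e: "L2_orthonormal_basis D e" and "finite I"
  shows "(L2_norm D (\<lambda>x. \<Sum>k\<in>I. c k * e k x))\<^sup>2 = (\<Sum>k\<in>I. (c k)\<^sup>2)"
proof -
  have eL: "e k \<in> L2 D" for k by (rule orthonormal_basis_in_L2[OF e])
  show ?thesis
    unfolding L2_norm_power2
    by (subst L2_inner_sum_left[OF eL L2_sum[OF eL]], subst L2_inner_commute)
      (simp add: L2_inner_sum_orthonormal[OF assms] power2_eq_square)
qed

text \<open>
  The squared norm of the remainder after \<open>n\<close> terms equals \<open>\<parallel>v\<parallel>\<^sup>2\<close> minus the sum of the first \<open>n\<close>
  squared coefficients, and completeness of the basis says that this remainder vanishes.
\<close>

lemma parseval: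
  assumes e: "L2_orthonormal_basis D e" and v: "v \<in> L2 D"
  shows "(\<lambda>k. (fourier D e v k)\<^sup>2) sums (L2_norm D v)\<^sup>2"
proof -
  define c where "c = fourier D e v"
  define s where "s n x = (\<Sum>k<n. c k * e k x)" for n x
  have eL: "e k \<in> L2 D" for k by (rule orthonormal_basis_in_L2[OF e])
  have sL: "s n \<in> L2 D" for n unfolding s_def by (rule L2_sum[OF eL])
  have vs: "L2_inner D v (s n) = (\<Sum>k<n. (c k)\<^sup>2)" for n
    unfolding s_def
    by (subst L2_inner_commute, subst L2_inner_sum_left[OF eL v])
      (simp add: c_def fourier_def L2_inner_commute[of D v] power2_eq_square)
  have ss: "L2_inner D (s n) (s n) = (\<Sum>k<n. (c k)\<^sup>2)" for n
    using L2_norm_sum_orthonormal[OF e, of "{..<n}" c] by (simp add: s_def[abs_def] L2_norm_power2)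
  have "(L2_norm D (\<lambda>x. v x - s n x))\<^sup>2 = (L2_norm D v)\<^sup>2 - (\<Sum>k<n. (c k)\<^sup>2)" for n
    using L2_inner_lincomb_self[OF v sL, of 1 "-1" n] by (simp add: L2_norm_power2 vs ss)
  then have "(\<Sum>k<n. (c k)\<^sup>2) = (L2_norm D v)\<^sup>2 - (L2_norm D (\<lambda>x. v x - s n x))\<^sup>2" for n
    by simp
  moreover have "(\<lambda>n. L2_norm D (\<lambda>x. v x - s n x)) \<longlonglongrightarrow> 0"
    using e v by (simp add: L2_orthonormal_basis_def s_def c_def fourier_def)
  then have "(\<lambda>n. (L2_norm D v)\<^sup>2 - (L2_norm D (\<lambda>x. v x - s n x))\<^sup>2) \<longlonglongrightarrow> (L2_norm D v)\<^sup>2 - 0\<^sup>2"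
    by (intro tendsto_intros)
  ultimately show ?thesis
    by (simp add: sums_def c_def)
qed

text \<open>
  Partial sums of \<open>\<Sum>\<^sub>k c\<^sub>k e\<^sub>k\<close> are Cauchy in \<open>L\<^sup>2\<close>, hence, the measure being finite, in \<open>L\<^sup>1\<close>, so a
  subsequence converges almost everywhere.  Fatou's lemma bounds the squared distance from the limit to the \<open>n\<close>th
  partial sum by the tail \<open>T n\<close> of the coefficients; this gives both membership in \<open>L\<^sup>2\<close> and,
  by Cauchy--Schwarz, the value of each coefficient.
\<close>

lemma riesz_fischer:
  assumes fin: "finite_measure (lebesgue_on D)"
    and e: "L2_orthonormal_basis D e" and c: "summable (\<lambda>k. (c k)\<^sup>2)"
  shows "\<exists>v\<in>L2 D. fourier D e v = c"
proof -
  interpret finite_measure "lebesgue_on D" by (rule fin)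
  let ?N = "lebesgue_on D"
  define s where "s n x = (\<Sum>k<n. c k * e k x)" for n x
  define T where "T n = (\<Sum>k. (c (k + n))\<^sup>2)" for n
  have eL: "e k \<in> L2 D" for k by (rule orthonormal_basis_in_L2[OF e])
  have sL: "s n \<in> L2 D" for n unfolding s_def by (rule L2_sum[OF eL])
  have dL: "(\<lambda>x. s i x - s j x) \<in> L2 D" for i j by (rule L2_diff[OF sL sL])
  note [measurable] = L2_measurable[OF sL]
  have T0: "T \<longlonglongrightarrow> 0"
    unfolding T_def using suminf_exist_split2[OF c] by simp
  have le: "(L2_norm D (\<lambda>x. s i x - s n x))\<^sup>2 \<le> T n" if "n \<le> i" for i n
  proof -
    have "(\<lambda>x. s i x - s n x) = (\<lambda>x. \<Sum>k\<in>{n..<i}. c k * e k x)"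
      using that by (simp add: s_def sum_diff_nat_ivl flip: atLeast0LessThan)
    then have "(L2_norm D (\<lambda>x. s i x - s n x))\<^sup>2 = (\<Sum>k\<in>{n..<i}. (c k)\<^sup>2)"
      by (simp add: L2_norm_sum_orthonormal[OF e])
    also have "\<dots> = (\<Sum>k<i-n. (c (k + n))\<^sup>2)"
      using that sum.shift_bounds_nat_ivl[of "\<lambda>k. (c k)\<^sup>2" 0 n "i - n"] by (simp add: atLeast0LessThan)
    also have "\<dots> \<le> T n"
      unfolding T_def by (rule sum_le_suminf) (use c summable_iff_shift[of "\<lambda>k. (c k)\<^sup>2" n] in auto)
    finally show ?thesis .
  qed
  have one: "(\<lambda>x. 1) \<in> L2 D" by (simp add: L2_def)
  have L1: "(LINT x|?N. norm (s i x - s n x)) \<le> sqrt (T n) * L2_norm D (\<lambda>x. 1)" if "n \<le> i" for i n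
  proof -
    have "(\<lambda>x. \<bar>s i x - s n x\<bar>) \<in> L2 D" using dL[of i n] by (simp add: L2_def)
    from L2_Cauchy_Schwarz[OF this one]
    have "(LINT x|?N. norm (s i x - s n x)) \<le> L2_norm D (\<lambda>x. \<bar>s i x - s n x\<bar>) * L2_norm D (\<lambda>x. 1)"
      by (simp add: L2_inner_def)
    also have "L2_norm D (\<lambda>x. \<bar>s i x - s n x\<bar>) = L2_norm D (\<lambda>x. s i x - s n x)"
      by (simp add: L2_norm_def L2_inner_def)
    also have "\<dots> * L2_norm D (\<lambda>x. 1) \<le> sqrt (T n) * L2_norm D (\<lambda>x. 1)"
      by (intro mult_right_mono real_le_rsqrt le that L2_norm_nonneg)
    finally show ?thesis .
  qed
  have cauchy: "\<exists>N. \<forall>i\<ge>N. \<forall>j\<ge>N. (LINT x|?N. norm (s i x - s j x)) < \<epsilon>" if "\<epsilon> > 0" for \<epsilon>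
  proof -
    have "(\<lambda>n. sqrt (T n) * L2_norm D (\<lambda>x. 1)) \<longlonglongrightarrow> sqrt 0 * L2_norm D (\<lambda>x. 1)"
      by (intro tendsto_intros T0)
    then have "\<forall>\<^sub>F n in sequentially. sqrt (T n) * L2_norm D (\<lambda>x. 1) < \<epsilon>"
      using that by (intro order_tendstoD) auto
    then obtain N where N: "\<And>n. n \<ge> N \<Longrightarrow> sqrt (T n) * L2_norm D (\<lambda>x. 1) < \<epsilon>"
      by (auto simp: eventually_sequentially)
    have "(LINT x|?N. norm (s i x - s j x)) < \<epsilon>" if "i \<ge> N" "j \<ge> N" for i j
    proof (cases "j \<le> i")
      case True
      then show ?thesis using L1[of j i] N[OF that(2)] by linarith
    next
      case False
      then have "(LINT x|?N. norm (s j x - s i x)) < \<epsilon>"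
        using L1[of i j] N[OF that(1)] by linarith
      then show ?thesis by (simp only: norm_minus_commute)
    qed
    then show ?thesis by blast
  qed
  have "integrable ?N (s n)" for n
    by (rule square_integrable_imp_integrable[OF L2_measurable[OF sL] L2_square_integrable[OF sL]])
  from cauchy_L1_AE_cauchy_subseq[OF this cauchy]
  obtain r where r: "strict_mono r" "AE x in ?N. Cauchy (\<lambda>i. s (r i) x)"
    by metis
  define v where "v x = lim (\<lambda>i. s (r i) x)" for x
  have vm[measurable]: "v \<in> borel_measurable ?N"
    unfolding v_def by measurable
  have lim: "AE x in ?N. (\<lambda>i. s (r i) x) \<longlonglongrightarrow> v x"
    using r(2) by eventually_elim (metis Cauchy_convergent_iff convergent_LIMSEQ_iff v_def)
  have fatou: "(\<integral>\<^sup>+x. ennreal ((v x - s n x)\<^sup>2) \<partial>?N) \<le> ennreal (T n)" for n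
  proof -
    have "(\<integral>\<^sup>+x. ennreal ((v x - s n x)\<^sup>2) \<partial>?N)
        = (\<integral>\<^sup>+x. liminf (\<lambda>i. ennreal ((s (r i) x - s n x)\<^sup>2)) \<partial>?N)"
    proof (rule nn_integral_cong_AE, use lim in eventually_elim)
      case (elim x)
      have "(\<lambda>i. ennreal ((s (r i) x - s n x)\<^sup>2)) \<longlonglongrightarrow> ennreal ((v x - s n x)\<^sup>2)"
        by (intro tendsto_intros elim)
      then show ?case
        using lim_imp_Liminf[OF sequentially_bot] by metis
    qed
    also have "\<dots> \<le> liminf (\<lambda>i. \<integral>\<^sup>+x. ennreal ((s (r i) x - s n x)\<^sup>2) \<partial>?N)"
      by (rule nn_integral_liminf) measurable
    also have "\<dots> \<le> liminf (\<lambda>i. ennreal (T n))"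
    proof (rule Liminf_mono)
      have "(\<integral>\<^sup>+x. ennreal ((s (r i) x - s n x)\<^sup>2) \<partial>?N) \<le> ennreal (T n)" if "i \<ge> n" for i
      proof -
        have "(\<integral>\<^sup>+x. ennreal ((s (r i) x - s n x)\<^sup>2) \<partial>?N) = ennreal ((L2_norm D (\<lambda>x. s (r i) x - s n x))\<^sup>2)"
          unfolding L2_norm_power2 L2_inner_def power2_eq_square[symmetric]
          by (rule nn_integral_eq_integral) (use dL in \<open>auto simp: L2_def\<close>)
        also have "\<dots> \<le> ennreal (T n)"
          using that seq_suble[OF r(1), of i] by (intro ennreal_leI le) simp
        finally show ?thesis .
      qed
      then show "\<forall>\<^sub>F i in sequentially. (\<integral>\<^sup>+x. ennreal ((s (r i) x - s n x)\<^sup>2) \<partial>?N) \<le> ennreal (T n)"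
        by (auto simp: eventually_sequentially)
    qed
    also have "\<dots> = ennreal (T n)" by (simp add: Liminf_const)
    finally show ?thesis .
  qed
  have Tnn: "T n \<ge> 0" for n unfolding T_def by (rule suminf_nonneg) (use c summable_iff_shift[of "\<lambda>k. (c k)\<^sup>2" n] in auto)
  have vsL: "(\<lambda>x. v x - s n x) \<in> L2 D" for n
  proof -
    have "(\<lambda>x. v x - s n x) \<in> borel_measurable ?N" by measurable
    moreover have "(\<integral>\<^sup>+x. ennreal ((v x - s n x)\<^sup>2) \<partial>?N) < \<infinity>"
      using fatou[of n] by (rule le_less_trans) simp
    ultimately show ?thesis
      by (simp add: L2_def integrable_iff_bounded)
  qed
  have vsn: "L2_norm D (\<lambda>x. v x - s n x) \<le> sqrt (T n)" for n
  proof (rule real_le_rsqrt)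
    have "ennreal ((L2_norm D (\<lambda>x. v x - s n x))\<^sup>2) = (\<integral>\<^sup>+x. ennreal ((v x - s n x)\<^sup>2) \<partial>?N)"
      unfolding L2_norm_power2 L2_inner_def power2_eq_square[symmetric]
      by (rule nn_integral_eq_integral[symmetric]) (use vsL in \<open>auto simp: L2_def\<close>)
    then show "(L2_norm D (\<lambda>x. v x - s n x))\<^sup>2 \<le> T n"
      using fatou[of n] Tnn[of n] by (metis ennreal_le_iff)
  qed
  have vL: "v \<in> L2 D"
    using L2_lincomb[OF vsL[of 0] sL[of 0], of 1 1] by simp
  have "fourier D e v k = c k" for k
  proof -
    have "\<bar>fourier D e v k - c k\<bar> \<le> sqrt (T n)" if "n > k" for n
    proof -
      have "fourier D e v k - c k = L2_inner D (\<lambda>x. v x - s n x) (e k)"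
        using that by (simp add: L2_inner_diff_left[OF vL sL eL] fourier_def)
          (simp add: s_def[abs_def] L2_inner_sum_orthonormal[OF e])
      also have "\<bar>\<dots>\<bar> \<le> L2_norm D (\<lambda>x. v x - s n x) * L2_norm D (e k)"
        by (rule L2_Cauchy_Schwarz[OF vsL eL])
      also have "L2_norm D (e k) = 1"
        using e by (simp add: L2_norm_def L2_orthonormal_basis_def)
      finally show ?thesis using vsn[of n] by simp
    qed
    moreover have "(\<lambda>n. sqrt (T n)) \<longlonglongrightarrow> sqrt 0" by (intro tendsto_intros T0)
    ultimately have "\<bar>fourier D e v k - c k\<bar> \<le> sqrt 0"
      by (intro tendsto_lowerbound[of "\<lambda>n. sqrt (T n)"])
        (auto simp: eventually_sequentially intro!: exI[of _ "Suc k"])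
    then show ?thesis by simp
  qed
  then show ?thesis using vL by blast
qed

lemma fourier_diff:
  assumes e: "L2_orthonormal_basis D e" and "u \<in> L2 D" "v \<in> L2 D"
  shows "fourier D e (\<lambda>x. u x - v x) = (\<lambda>k. fourier D e u k - fourier D e v k)"
  using assms(2,3) by (simp add: fourier_def L2_inner_diff_left orthonormal_basis_in_L2[OF e])

section \<open>The spectral scale of Hilbert spaces\<close>

lemma square_summable_add:
  fixes a b :: "nat \<Rightarrow> real"
  assumes "summable (\<lambda>k. (a k)\<^sup>2)" "summable (\<lambda>k. (b k)\<^sup>2)"
  shows "summable (\<lambda>k. (a k + b k)\<^sup>2)"
    and "sqrt (\<Sum>k. (a k + b k)\<^sup>2) \<le> sqrt (\<Sum>k. (a k)\<^sup>2) + sqrt (\<Sum>k. (b k)\<^sup>2)"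
proof -
  let ?B = "sqrt (\<Sum>k. (a k)\<^sup>2) + sqrt (\<Sum>k. (b k)\<^sup>2)"
  have B: "?B \<ge> 0" by (simp add: assms suminf_nonneg)
  have *: "(\<Sum>k<n. (a k + b k)\<^sup>2) \<le> ?B\<^sup>2" for n
  proof -
    have "sqrt (\<Sum>k<n. (a k + b k)\<^sup>2) \<le> sqrt (\<Sum>k<n. (a k)\<^sup>2) + sqrt (\<Sum>k<n. (b k)\<^sup>2)"
      using L2_set_triangle_ineq[of a b "{..<n}"] by (simp add: L2_set_def)
    also have "\<dots> \<le> ?B"
      by (intro add_mono real_sqrt_le_mono sum_le_suminf assms) auto
    finally have "(sqrt (\<Sum>k<n. (a k + b k)\<^sup>2))\<^sup>2 \<le> ?B\<^sup>2"
      by (rule power_mono) (simp add: sum_nonneg)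
    then show ?thesis by (simp add: sum_nonneg)
  qed
  show s: "summable (\<lambda>k. (a k + b k)\<^sup>2)"
    by (rule summableI_nonneg_bounded[OF _ *]) simp
  show "sqrt (\<Sum>k. (a k + b k)\<^sup>2) \<le> ?B"
    by (rule real_le_lsqrt[OF B]) (rule suminf_le_const[OF s *])
qed

lemma powr_mult_square: "lam powr s * x\<^sup>2 = (lam powr (s / 2) * x)\<^sup>2" for lam s x :: real
  by (simp add: power_mult_distrib powr_power power2_eq_square[of "_ powr _"] flip: powr_add)

lemma Hdot_add: "b \<in> Hdot lam s \<Longrightarrow> c \<in> Hdot lam s \<Longrightarrow> (\<lambda>k. b k + c k) \<in> Hdot lam s"
  using square_summable_add(1)[of "\<lambda>k. lam k powr (s / 2) * b k" "\<lambda>k. lam k powr (s / 2) * c k"]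
  by (simp add: Hdot_def powr_mult_square distrib_left)

lemma Hdot_norm_add:
  "b \<in> Hdot lam s \<Longrightarrow> c \<in> Hdot lam s \<Longrightarrow>
    Hdot_norm lam s (\<lambda>k. b k + c k) \<le> Hdot_norm lam s b + Hdot_norm lam s c"
  using square_summable_add(2)[of "\<lambda>k. lam k powr (s / 2) * b k" "\<lambda>k. lam k powr (s / 2) * c k"]
  by (simp add: Hdot_def Hdot_norm_def powr_mult_square distrib_left)

lemma Hdot_uminus: "b \<in> Hdot lam s \<Longrightarrow> (\<lambda>k. - b k) \<in> Hdot lam s"
  by (simp add: Hdot_def)

lemma Hdot_diff: "b \<in> Hdot lam s \<Longrightarrow> c \<in> Hdot lam s \<Longrightarrow> (\<lambda>k. b k - c k) \<in> Hdot lam s"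
  using Hdot_add[OF _ Hdot_uminus, of b lam s c] by simp

lemma Hdot_zero: "(\<lambda>k. 0) \<in> Hdot lam s"
  by (simp add: Hdot_def)

lemma Hdot_norm_nonneg: "c \<in> Hdot lam s \<Longrightarrow> Hdot_norm lam s c \<ge> 0"
  by (simp add: Hdot_def Hdot_norm_def suminf_nonneg)

lemma Hdot_norm_commute: "Hdot_norm lam s (\<lambda>k. b k - c k) = Hdot_norm lam s (\<lambda>k. c k - b k)"
  by (simp add: Hdot_norm_def power2_commute)

lemma Hdot_norm_triangle:
  assumes "a \<in> Hdot lam s" "b \<in> Hdot lam s" "c \<in> Hdot lam s"
  shows "Hdot_norm lam s (\<lambda>k. a k - c k) \<le>
         Hdot_norm lam s (\<lambda>k. a k - b k) + Hdot_norm lam s (\<lambda>k. b k - c k)"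
  using Hdot_norm_add[OF Hdot_diff[OF assms(1,2)] Hdot_diff[OF assms(2,3)]] by simp

lemma Hdot_norm_diff_abs:
  assumes "b \<in> Hdot lam s" "c \<in> Hdot lam s"
  shows "\<bar>Hdot_norm lam s b - Hdot_norm lam s c\<bar> \<le> Hdot_norm lam s (\<lambda>k. b k - c k)"
  using Hdot_norm_triangle[OF assms(1,2) Hdot_zero] Hdot_norm_triangle[OF assms(2,1) Hdot_zero]
    Hdot_norm_commute[of lam s b c] by simp

lemma Hdot_norm_power2:
  "c \<in> Hdot lam s \<Longrightarrow> (Hdot_norm lam s c)\<^sup>2 = (\<Sum>k. lam k powr s * (c k)\<^sup>2)"
  by (simp add: Hdot_def Hdot_norm_def suminf_nonneg)

lemma Hdot_coeff_le:
  assumes "c \<in> Hdot lam s"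
  shows "lam k powr (s / 2) * \<bar>c k\<bar> \<le> Hdot_norm lam s c"
proof -
  have "(\<Sum>j\<in>{k}. lam j powr s * (c j)\<^sup>2) \<le> (\<Sum>k. lam k powr s * (c k)\<^sup>2)"
    using assms by (intro sum_le_suminf) (auto simp: Hdot_def)
  then have "(lam k powr (s / 2) * \<bar>c k\<bar>)\<^sup>2 \<le> (\<Sum>k. lam k powr s * (c k)\<^sup>2)"
    by (simp add: powr_mult_square power_mult_distrib)
  then show ?thesis
    unfolding Hdot_norm_def by (rule real_le_rsqrt)
qed

lemma Hdot_norm_le:
  assumes "\<And>n. (\<Sum>k<n. lam k powr s * (c k)\<^sup>2) \<le> B\<^sup>2" "B \<ge> 0"
  shows "c \<in> Hdot lam s" "Hdot_norm lam s c \<le> B"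
proof -
  have s: "summable (\<lambda>k. lam k powr s * (c k)\<^sup>2)"
    by (rule summableI_nonneg_bounded[OF _ assms(1)]) simp
  then show "c \<in> Hdot lam s" by (simp add: Hdot_def)
  show "Hdot_norm lam s c \<le> B"
    unfolding Hdot_norm_def
    by (rule real_le_lsqrt[OF assms(2)]) (rule suminf_le_const[OF s assms(1)])
qed

lemma Hdot_comparison:
  assumes c: "c \<in> Hdot lam t" and C: "C \<ge> 0"
    and le: "\<And>k. lam k powr s * (b k)\<^sup>2 \<le> C\<^sup>2 * (lam k powr t * (c k)\<^sup>2)"
  shows "b \<in> Hdot lam s" "Hdot_norm lam s b \<le> C * Hdot_norm lam t c"
proof -
  have *: "(\<Sum>k<n. lam k powr s * (b k)\<^sup>2) \<le> (C * Hdot_norm lam t c)\<^sup>2" for n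
  proof -
    have "(\<Sum>k<n. lam k powr s * (b k)\<^sup>2) \<le> C\<^sup>2 * (\<Sum>k<n. lam k powr t * (c k)\<^sup>2)"
      unfolding sum_distrib_left by (intro sum_mono le)
    also have "\<dots> \<le> C\<^sup>2 * (\<Sum>k. lam k powr t * (c k)\<^sup>2)"
      using c by (intro mult_left_mono sum_le_suminf) (auto simp: Hdot_def)
    finally show ?thesis by (simp add: power_mult_distrib Hdot_norm_power2[OF c])
  qed
  have nn: "C * Hdot_norm lam t c \<ge> 0" using C Hdot_norm_nonneg[OF c] by simp
  show "b \<in> Hdot lam s" "Hdot_norm lam s b \<le> C * Hdot_norm lam t c"
    by (rule Hdot_norm_le[OF * nn])+
qed

lemma Hdot_embedding:
  assumes l: "\<And>k. l \<le> lam k" "l > 0" and st: "s \<le> t" and c: "c \<in> Hdot lam t"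
  shows "c \<in> Hdot lam s" "Hdot_norm lam s c \<le> l powr ((s - t) / 2) * Hdot_norm lam t c"
proof -
  have "lam k powr s * (c k)\<^sup>2 \<le> (l powr ((s - t) / 2))\<^sup>2 * (lam k powr t * (c k)\<^sup>2)" for k
  proof -
    have "lam k powr s = lam k powr (s - t) * lam k powr t"
      by (simp flip: powr_add)
    also have "\<dots> \<le> l powr (s - t) * lam k powr t"
      using st l by (intro mult_right_mono powr_mono2') auto
    also have "l powr (s - t) = (l powr ((s - t) / 2))\<^sup>2"
      by (simp add: power2_eq_square flip: powr_add)
    finally show ?thesis
      by (metis mult.assoc mult_right_mono zero_le_power2)
  qed
  then show "c \<in> Hdot lam s" "Hdot_norm lam s c \<le> l powr ((s - t) / 2) * Hdot_norm lam t c"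
    using Hdot_comparison[OF c, of "l powr ((s - t) / 2)" s c] by simp_all
qed

lemma A_pow_Hdot_eq:
  "lam k powr s * (A_pow lam r c k)\<^sup>2 = lam k powr (s + 2 * r) * (c k)\<^sup>2"
proof -
  have "(lam k powr r)\<^sup>2 = lam k powr (2 * r)"
    by (simp add: power2_eq_square flip: powr_add)
  then show ?thesis
    by (simp add: A_pow_def power_mult_distrib powr_add)
qed

lemma A_pow_in_Hdot_iff: "A_pow lam r c \<in> Hdot lam s \<longleftrightarrow> c \<in> Hdot lam (s + 2 * r)"
  by (simp add: Hdot_def A_pow_Hdot_eq)

lemma Hdot_norm_A_pow: "Hdot_norm lam s (A_pow lam r c) = Hdot_norm lam (s + 2 * r) c"
  by (simp add: Hdot_norm_def A_pow_Hdot_eq)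

lemma A_pow_diff: "(\<lambda>k. A_pow lam r b k - A_pow lam r c k) = A_pow lam r (\<lambda>k. b k - c k)"
  by (simp add: A_pow_def right_diff_distrib)

text \<open>
  The absolute value makes the distance nonnegative for arbitrary sequences: outside the space the
  norm series may diverge and its sum is then an unspecified number.
\<close>

lemma Hdot_Metric_space:
  assumes pos: "\<And>k. lam k > 0"
  shows "Metric_space (Hdot lam s) (\<lambda>b c. \<bar>Hdot_norm lam s (\<lambda>k. b k - c k)\<bar>)"
proof
  fix b c assume bc: "b \<in> Hdot lam s" "c \<in> Hdot lam s"
  show "\<bar>Hdot_norm lam s (\<lambda>k. b k - c k)\<bar> = 0 \<longleftrightarrow> b = c"
  proof
    assume "\<bar>Hdot_norm lam s (\<lambda>k. b k - c k)\<bar> = 0"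
    then have *: "lam k powr (s / 2) * \<bar>b k - c k\<bar> \<le> 0" for k
      using Hdot_coeff_le[OF Hdot_diff[OF bc], of k] by simp
    have "b k = c k" for k
      using *[of k] pos[of k] by (auto simp: mult_le_0_iff)
    then show "b = c" by auto
  qed (simp add: Hdot_norm_def)
next
  fix a b c assume abc: "a \<in> Hdot lam s" "b \<in> Hdot lam s" "c \<in> Hdot lam s"
  show "\<bar>Hdot_norm lam s (\<lambda>k. a k - c k)\<bar> \<le>
      \<bar>Hdot_norm lam s (\<lambda>k. a k - b k)\<bar> + \<bar>Hdot_norm lam s (\<lambda>k. b k - c k)\<bar>"
    using Hdot_norm_triangle[OF abc] Hdot_norm_nonneg[OF Hdot_diff[OF abc(1) abc(3)]] by linarith
next
  fix b c show "\<bar>Hdot_norm lam s (\<lambda>k. b k - c k)\<bar> = \<bar>Hdot_norm lam s (\<lambda>k. c k - b k)\<bar>"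
    by (subst Hdot_norm_commute) (rule refl)
qed simp

text \<open>
  A Cauchy sequence converges in every coordinate because the weights are positive.  Letting one
  index tend to infinity in the Cauchy estimate, first in finitely many coordinates, shows that
  the coordinatewise limit is also the limit in norm.
\<close>

lemma Hdot_mcomplete:
  assumes pos: "\<And>k. lam k > 0"
  shows "Metric_space.mcomplete (Hdot lam s) (\<lambda>b c. \<bar>Hdot_norm lam s (\<lambda>k. b k - c k)\<bar>)"
proof -
  interpret Metric_space "Hdot lam s" "\<lambda>b c. \<bar>Hdot_norm lam s (\<lambda>k. b k - c k)\<bar>"
    by (rule Hdot_Metric_space[OF pos])
  have "\<exists>x. limitin mtopology \<sigma> x sequentially" if "MCauchy \<sigma>" for \<sigma>
  proof -
    have mem: "\<sigma> n \<in> Hdot lam s" for n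
      using that by (auto simp: MCauchy_def)
    have cau: "\<exists>N. \<forall>n\<ge>N. \<forall>m\<ge>N. Hdot_norm lam s (\<lambda>k. \<sigma> n k - \<sigma> m k) < \<epsilon>" if "\<epsilon> > 0" for \<epsilon>
      using \<open>MCauchy \<sigma>\<close> that unfolding MCauchy_def by (meson abs_ge_self le_less_trans)
    have cauk: "Cauchy (\<lambda>n. \<sigma> n k)" for k
    proof (rule metric_CauchyI)
      fix e :: real assume "e > 0"
      define q where "q = lam k powr (s / 2)"
      have q: "q > 0" using pos[of k] by (simp add: q_def)
      obtain N where N: "\<forall>n\<ge>N. \<forall>m\<ge>N. Hdot_norm lam s (\<lambda>k. \<sigma> n k - \<sigma> m k) < q * e"
        using cau[of "q * e"] q \<open>e > 0\<close> by auto
      have "dist (\<sigma> n k) (\<sigma> m k) < e" if "n \<ge> N" "m \<ge> N" for n m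
      proof -
        have "q * \<bar>\<sigma> n k - \<sigma> m k\<bar> < q * e"
          using Hdot_coeff_le[OF Hdot_diff[OF mem mem], of k n m] N that
          unfolding q_def by (meson le_less_trans)
        then show ?thesis using q by (simp add: dist_real_def)
      qed
      then show "\<exists>M. \<forall>m\<ge>M. \<forall>n\<ge>M. dist (\<sigma> m k) (\<sigma> n k) < e" by blast
    qed
    define c where "c k = lim (\<lambda>n. \<sigma> n k)" for k
    have c: "(\<lambda>n. \<sigma> n k) \<longlonglongrightarrow> c k" for k
      using Cauchy_convergent[OF cauk[of k]]
      unfolding c_def by (simp only: convergent_LIMSEQ_iff)
    have close: "\<exists>N. \<forall>n\<ge>N. (\<lambda>k. \<sigma> n k - c k) \<in> Hdot lam s \<and> Hdot_norm lam s (\<lambda>k. \<sigma> n k - c k) \<le> \<epsilon>"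
      if "\<epsilon> > 0" for \<epsilon>
    proof -
      obtain N where N: "\<And>n m. n \<ge> N \<Longrightarrow> m \<ge> N \<Longrightarrow> Hdot_norm lam s (\<lambda>k. \<sigma> n k - \<sigma> m k) < \<epsilon>"
        using cau[OF \<open>\<epsilon> > 0\<close>] by blast
      have "(\<Sum>k<K. lam k powr s * (\<sigma> n k - c k)\<^sup>2) \<le> \<epsilon>\<^sup>2" if n: "n \<ge> N" for n K
      proof (rule tendsto_upperbound)
        show "(\<lambda>m. \<Sum>k<K. lam k powr s * (\<sigma> n k - \<sigma> m k)\<^sup>2) \<longlonglongrightarrow> (\<Sum>k<K. lam k powr s * (\<sigma> n k - c k)\<^sup>2)"
          by (intro tendsto_intros c)
        have "(\<Sum>k<K. lam k powr s * (\<sigma> n k - \<sigma> m k)\<^sup>2) \<le> \<epsilon>\<^sup>2" if m: "m \<ge> N" for m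
        proof -
          have d: "(\<lambda>k. \<sigma> n k - \<sigma> m k) \<in> Hdot lam s" by (rule Hdot_diff[OF mem mem])
          have "(\<Sum>k<K. lam k powr s * (\<sigma> n k - \<sigma> m k)\<^sup>2) \<le> (Hdot_norm lam s (\<lambda>k. \<sigma> n k - \<sigma> m k))\<^sup>2"
            unfolding Hdot_norm_power2[OF d]
            using d by (intro sum_le_suminf) (auto simp: Hdot_def)
          also have "\<dots> \<le> \<epsilon>\<^sup>2"
            using N[OF n m] by (intro power_mono less_imp_le Hdot_norm_nonneg d)
          finally show ?thesis .
        qed
        then show "\<forall>\<^sub>F m in sequentially. (\<Sum>k<K. lam k powr s * (\<sigma> n k - \<sigma> m k)\<^sup>2) \<le> \<epsilon>\<^sup>2"
          by (auto simp: eventually_sequentially)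
      qed simp
      then show ?thesis
        using Hdot_norm_le[of lam s _ \<epsilon>] \<open>\<epsilon> > 0\<close> by (metis less_imp_le)
    qed
    obtain N where "(\<lambda>k. \<sigma> N k - c k) \<in> Hdot lam s"
      using close[of 1] by auto
    then have "c \<in> Hdot lam s"
      using Hdot_diff[OF mem[of N]] by fastforce
    moreover have "\<exists>N. \<forall>n\<ge>N. \<bar>Hdot_norm lam s (\<lambda>k. \<sigma> n k - c k)\<bar> < \<epsilon>" if "\<epsilon> > 0" for \<epsilon>
    proof -
      obtain N where N: "\<And>n. n \<ge> N \<Longrightarrow> (\<lambda>k. \<sigma> n k - c k) \<in> Hdot lam s"
          "\<And>n. n \<ge> N \<Longrightarrow> Hdot_norm lam s (\<lambda>k. \<sigma> n k - c k) \<le> \<epsilon> / 2"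
        using close[of "\<epsilon> / 2"] half_gt_zero[OF \<open>\<epsilon> > 0\<close>] by blast
      have "\<bar>Hdot_norm lam s (\<lambda>k. \<sigma> n k - c k)\<bar> < \<epsilon>" if "n \<ge> N" for n
        using Hdot_norm_nonneg[OF N(1)[OF that]] N(2)[OF that] \<open>\<epsilon> > 0\<close> by linarith
      then show ?thesis by blast
    qed
    ultimately have "limitin mtopology \<sigma> c sequentially"
      by (simp add: limit_metric_sequentially mem)
    then show ?thesis by blast
  qed
  then show ?thesis by (simp add: mcomplete_def)
qed

lemma L2_Hdot_zero:
  assumes e: "L2_orthonormal_basis D e" and pos: "\<And>k. lam k > 0" and v: "v \<in> L2 D"
  shows "fourier D e v \<in> Hdot lam 0" "Hdot_norm lam 0 (fourier D e v) = L2_norm D v"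
proof -
  have lam0: "lam k powr 0 = 1" for k using pos[of k] by simp
  show "fourier D e v \<in> Hdot lam 0"
    using parseval[OF e v] by (simp only: Hdot_def lam0 sums_iff mem_Collect_eq mult_1)
  show "Hdot_norm lam 0 (fourier D e v) = L2_norm D v"
    using parseval[OF e v] L2_norm_nonneg[of D v]
    by (simp only: Hdot_norm_def lam0 sums_iff mult_1 real_sqrt_abs abs_of_nonneg)
qed

section \<open>Measurability of Lipschitz maps\<close>

lemma space_metric_borel: "space (metric_borel S d) = S"
  unfolding metric_borel_def by (rule space_measure_of) auto

lemma metric_borel_open_in_sets:
  "U \<subseteq> S \<Longrightarrow> (\<And>x. x \<in> U \<Longrightarrow> \<exists>e>0. \<forall>y\<in>S. d x y < e \<longrightarrow> y \<in> U) \<Longrightarrow> U \<in> sets (metric_borel S d)"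
  unfolding metric_borel_def by (subst sets_measure_of) auto

text \<open>
  With \<open>d'\<close> the pseudometric of \<open>L\<^sup>2(D)\<close>, \<open>h\<close> may select representatives arbitrarily: a Lipschitz bound on the distances makes any such
  selection measurable.
\<close>

lemma lipschitz_measurable_metric_borel:
  assumes h: "\<And>x. x \<in> S \<Longrightarrow> h x \<in> T" and C: "C > 0"
    and lip: "\<And>x y. x \<in> S \<Longrightarrow> y \<in> S \<Longrightarrow> d' (h x) (h y) \<le> C * d x y"
  shows "h \<in> measurable (metric_borel S d) (metric_borel T d')"
  unfolding metric_borel_def[of T]
proof (rule measurable_measure_of)
  fix U assume "U \<in> {U. U \<subseteq> T \<and> (\<forall>x\<in>U. \<exists>e>0. \<forall>y\<in>T. d' x y < e \<longrightarrow> y \<in> U)}"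
  then have U: "\<And>x. x \<in> U \<Longrightarrow> \<exists>e>0. \<forall>y\<in>T. d' x y < e \<longrightarrow> y \<in> U" by blast
  show "h -` U \<inter> space (metric_borel S d) \<in> sets (metric_borel S d)"
    unfolding space_metric_borel
  proof (rule metric_borel_open_in_sets)
    fix x assume x: "x \<in> h -` U \<inter> S"
    then obtain e where e: "e > 0" "\<And>y. y \<in> T \<Longrightarrow> d' (h x) y < e \<Longrightarrow> y \<in> U"
      using U[of "h x"] by blast
    have "y \<in> h -` U \<inter> S" if "y \<in> S" "d x y < e / C" for y
    proof -
      have "d' (h x) (h y) \<le> C * d x y" using lip x that(1) by blast
      also have "\<dots> < e" using that(2) C by (simp add: field_simps)
      finally show ?thesis using e(2)[OF h[OF that(1)]] that(1) by simp
    qed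
    then show "\<exists>e>0. \<forall>y\<in>S. d x y < e \<longrightarrow> y \<in> h -` U \<inter> S"
      using e(1) C by (intro exI[of _ "e / C"]) simp
  qed simp
qed (use h in \<open>auto simp: space_metric_borel\<close>)

lemma lipschitz_borel_measurable:
  fixes h :: "'b \<Rightarrow> real"
  assumes C: "C > 0" and lip: "\<And>x y. x \<in> S \<Longrightarrow> y \<in> S \<Longrightarrow> \<bar>h x - h y\<bar> \<le> C * d x y"
  shows "h \<in> borel_measurable (metric_borel S d)"
proof (rule borel_measurableI)
  fix U :: "real set" assume U: "open U"
  show "h -` U \<inter> space (metric_borel S d) \<in> sets (metric_borel S d)"
    unfolding space_metric_borel
  proof (rule metric_borel_open_in_sets)
    fix x assume x: "x \<in> h -` U \<inter> S"
    then obtain e where e: "e > 0" "\<And>y. \<bar>y - h x\<bar> < e \<Longrightarrow> y \<in> U"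
      using U unfolding open_dist by (auto simp: dist_real_def)
    have "y \<in> h -` U \<inter> S" if "y \<in> S" "d x y < e / C" for y
    proof -
      have "\<bar>h y - h x\<bar> \<le> C * d x y" using lip[of x y] x that(1) by (simp add: abs_minus_commute)
      also have "\<dots> < e" using that(2) C by (simp add: field_simps)
      finally show ?thesis using e(2) that(1) by simp
    qed
    then show "\<exists>e>0. \<forall>y\<in>S. d x y < e \<longrightarrow> y \<in> h -` U \<inter> S"
      using e(1) C by (intro exI[of _ "e / C"]) simp
  qed simp
qed

lemma Hdot_norm_measurable: "Hdot_norm lam s \<in> borel_measurable (Hdot_borel lam s)"
  unfolding Hdot_borel_def
  by (rule lipschitz_borel_measurable[of 1]) (use Hdot_norm_diff_abs in auto)

lemma Hdot_coeff_measurable: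
  assumes "lam k > 0"
  shows "(\<lambda>c. c k) \<in> borel_measurable (Hdot_borel lam s)"
  unfolding Hdot_borel_def
proof (rule lipschitz_borel_measurable)
  show "1 / lam k powr (s / 2) > 0" using assms by simp
  fix b c assume "b \<in> Hdot lam s" "c \<in> Hdot lam s"
  then show "\<bar>b k - c k\<bar> \<le> 1 / lam k powr (s / 2) * Hdot_norm lam s (\<lambda>k. b k - c k)"
    using Hdot_coeff_le[OF Hdot_diff, of b lam s c k] assms by (simp add: field_simps)
qed

section \<open>The deterministic semilinear problem\<close>

lemma Lip_norm_bound:
  assumes "L-lipschitz_on UNIV f"
  shows "0 \<le> Lip_norm f" "\<bar>f x - f y\<bar> \<le> Lip_norm f * \<bar>x - y\<bar>"
proof -
  let ?S = "{\<bar>f u - f v\<bar> / \<bar>u - v\<bar> | u v. u \<noteq> v}"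
  have "r \<le> L" if "r \<in> ?S" for r
    using that lipschitz_onD[OF assms] by (auto simp: dist_real_def field_simps)
  then have bdd: "bdd_above ?S" by (rule bdd_aboveI)
  have up: "\<bar>f u - f v\<bar> / \<bar>u - v\<bar> \<le> Lip_norm f" if "u \<noteq> v" for u v
    unfolding Lip_norm_def using that by (intro cSup_upper bdd) auto
  show "\<bar>f x - f y\<bar> \<le> Lip_norm f * \<bar>x - y\<bar>"
    using up[of x y] by (cases "x = y") (simp_all add: field_simps)
  show "0 \<le> Lip_norm f"
    using up[of 1 0] by (simp add: order_trans[OF abs_ge_zero])
qed

text \<open>
  Test the Poincare inequality on the unit vector \<open>\<phi>\<^sub>k\<close>, whose Dirichlet energy is \<open>\<lambda>\<^sub>k\<close>.
\<close>

lemma eigenvalue_ge_poincare: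
  assumes eigen: "dirichlet_eigensystem D lam phi"
    and poincare: "\<And>v. v \<in> H10 D \<Longrightarrow> grad_inner D v v \<ge> \<gamma> * (L2_norm D v)\<^sup>2"
  shows "\<gamma> \<le> lam k"
proof -
  have A: "neg_dirichlet_laplacian D (phi k) (\<lambda>x. lam k * phi k x)"
    and one: "L2_inner D (phi k) (phi k) = 1"
    using eigen by (simp_all add: dirichlet_eigensystem_def L2_orthonormal_basis_def)
  have H: "phi k \<in> H10 D" using A by (simp add: neg_dirichlet_laplacian_def)
  have "\<gamma> = \<gamma> * (L2_norm D (phi k))\<^sup>2" by (simp add: L2_norm_def one)
  also have "\<dots> \<le> grad_inner D (phi k) (phi k)" by (rule poincare[OF H])
  also have "\<dots> = L2_inner D (\<lambda>x. lam k * phi k x) (phi k)"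
    using A H by (simp add: neg_dirichlet_laplacian_def)
  also have "\<dots> = lam k * L2_inner D (phi k) (phi k)"
    by (simp add: L2_inner_def mult.assoc)
  finally show ?thesis by (simp add: one)
qed

text \<open>
  The setting in which the solution operator is built: a lower spectral bound \<open>l\<close> of \<open>A\<close> that
  exceeds a Lipschitz constant \<open>L\<close> of the nonlinearity.
\<close>

locale semilinear_dirichlet =
  fixes D :: "'a::euclidean_space set" and lam :: "nat \<Rightarrow> real" and phi :: "nat \<Rightarrow> 'a \<Rightarrow> real"
    and f :: "real \<Rightarrow> real" and l L :: real
  assumes fin: "finite_measure (lebesgue_on D)"
    and basis: "L2_orthonormal_basis D phi"
    and lam_ge: "\<And>k. l \<le> lam k"
    and lip: "\<And>x y. \<bar>f x - f y\<bar> \<le> L * \<bar>x - y\<bar>"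
    and L_nonneg: "0 \<le> L" and L_less: "L < l"
begin

abbreviation \<F> where "\<F> \<equiv> fourier D phi"

lemma l_pos: "l > 0" using L_nonneg L_less by simp

lemma lam_pos: "lam k > 0" using l_pos lam_ge[of k] by simp

lemmas \<F>_Hdot = L2_Hdot_zero[OF basis lam_pos]

lemma superposition_L2:
  assumes u: "u \<in> L2 D"
  shows "(\<lambda>x. f (u x)) \<in> L2 D"
proof -
  interpret finite_measure "lebesgue_on D" by (rule fin)
  have "L-lipschitz_on UNIV f"
    using lip L_nonneg by (intro lipschitz_onI) (auto simp: dist_real_def)
  then have fm: "f \<in> borel_measurable borel"
    by (intro borel_measurable_continuous_onI lipschitz_on_continuous_on)
  have m: "(\<lambda>x. f (u x)) \<in> borel_measurable (lebesgue_on D)"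
    by (rule measurable_compose[OF L2_measurable[OF u] fm])
  have le: "(f y)\<^sup>2 \<le> 2 * (f 0)\<^sup>2 + 2 * L\<^sup>2 * y\<^sup>2" for y
  proof -
    have "(f y)\<^sup>2 = (f 0 + (f y - f 0))\<^sup>2" by simp
    also have "\<dots> \<le> 2 * (f 0)\<^sup>2 + 2 * (f y - f 0)\<^sup>2"
      using zero_le_power2[of "f 0 - (f y - f 0)"] by (simp add: power2_eq_square algebra_simps)
    also have "(f y - f 0)\<^sup>2 \<le> (L * \<bar>y\<bar>)\<^sup>2"
      using lip[of y 0] by (metis abs_ge_zero diff_zero power2_abs power_mono)
    finally show ?thesis by (simp add: power_mult_distrib)
  qed
  have "integrable (lebesgue_on D) (\<lambda>x. (f (u x))\<^sup>2)"
  proof (rule Bochner_Integration.integrable_bound)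
    show "integrable (lebesgue_on D) (\<lambda>x. 2 * (f 0)\<^sup>2 + 2 * L\<^sup>2 * (u x)\<^sup>2)"
      using L2_square_integrable[OF u] by simp
    show "(\<lambda>x. (f (u x))\<^sup>2) \<in> borel_measurable (lebesgue_on D)"
      using m by (rule borel_measurable_power)
    show "AE x in lebesgue_on D. norm ((f (u x))\<^sup>2) \<le> norm (2 * (f 0)\<^sup>2 + 2 * L\<^sup>2 * (u x)\<^sup>2)"
      using le by simp
  qed
  then show ?thesis using m by (simp add: L2_def)
qed

lemma superposition_lipschitz:
  assumes u: "u \<in> L2 D" and v: "v \<in> L2 D"
  shows "L2_norm D (\<lambda>x. f (u x) - f (v x)) \<le> L * L2_norm D (\<lambda>x. u x - v x)"
proof -
  have "(L2_norm D (\<lambda>x. f (u x) - f (v x)))\<^sup>2 \<le> L\<^sup>2 * (L2_norm D (\<lambda>x. u x - v x))\<^sup>2"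
    unfolding L2_norm_power2 L2_inner_def power2_eq_square[symmetric] integral_mult_right_zero[symmetric]
  proof (rule integral_mono)
    show "integrable (lebesgue_on D) (\<lambda>x. (f (u x) - f (v x))\<^sup>2)"
      by (intro L2_square_integrable L2_diff superposition_L2 u v)
    show "integrable (lebesgue_on D) (\<lambda>x. L\<^sup>2 * (u x - v x)\<^sup>2)"
      by (intro integrable_mult_right L2_square_integrable L2_diff u v)
    show "(f (u x) - f (v x))\<^sup>2 \<le> L\<^sup>2 * (u x - v x)\<^sup>2" for x
      using power_mono[OF lip[of "u x" "v x"], of 2] by (simp add: power_mult_distrib)
  qed
  then show ?thesis
    using L_nonneg L2_norm_nonneg[of D "\<lambda>x. u x - v x"]
    by (auto intro: power2_le_imp_le[of _ "L * _"] simp: power_mult_distrib)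
qed

definition drift :: "('a \<Rightarrow> real) \<Rightarrow> nat \<Rightarrow> real" where
  "drift u = A_pow lam (-1) (\<F> (\<lambda>x. f (u x)))"

lemma drift_Hdot:
  assumes u: "u \<in> L2 D" and s: "s \<le> 2"
  shows "drift u \<in> Hdot lam s"
proof (rule Hdot_embedding(1)[OF lam_ge l_pos s])
  show "drift u \<in> Hdot lam 2"
    using \<F>_Hdot(1)[OF superposition_L2[OF u]] by (simp add: drift_def A_pow_in_Hdot_iff)
qed

text \<open>
  The map \<open>A\<^sup>-\<^sup>1 f\<close> is \<open>L\<close>-Lipschitz from \<open>L\<^sup>2(D)\<close> into \<open>Hdot lam 2\<close>; the power of \<open>l\<close> is the
  price of the embedding into \<open>Hdot lam s\<close>.  For \<open>s = 0\<close> the constant is \<open>L / l < 1\<close>, which is the contraction factor.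
\<close>

lemma drift_lipschitz:
  assumes u: "u \<in> L2 D" and v: "v \<in> L2 D" and s: "s \<le> 2"
  shows "Hdot_norm lam s (\<lambda>k. drift u k - drift v k) \<le>
         l powr ((s - 2) / 2) * (L * L2_norm D (\<lambda>x. u x - v x))"
proof -
  have fu: "(\<lambda>x. f (u x)) \<in> L2 D" and fv: "(\<lambda>x. f (v x)) \<in> L2 D"
    using superposition_L2 u v by blast+
  have "Hdot_norm lam s (\<lambda>k. drift u k - drift v k) \<le>
      l powr ((s - 2) / 2) * Hdot_norm lam 2 (\<lambda>k. drift u k - drift v k)"
    by (intro Hdot_embedding(2)[OF lam_ge l_pos s] Hdot_diff drift_Hdot u v) simp_all
  also have "Hdot_norm lam 2 (\<lambda>k. drift u k - drift v k) = L2_norm D (\<lambda>x. f (u x) - f (v x))"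
    using \<F>_Hdot(2)[OF L2_diff[OF fu fv]]
    by (simp add: drift_def A_pow_diff Hdot_norm_A_pow fourier_diff[OF basis fu fv])
  also have "l powr ((s - 2) / 2) * \<dots> \<le> l powr ((s - 2) / 2) * (L * L2_norm D (\<lambda>x. u x - v x))"
    by (intro mult_left_mono superposition_lipschitz u v) simp
  finally show ?thesis .
qed

definition solves :: "(nat \<Rightarrow> real) \<Rightarrow> ('a \<Rightarrow> real) \<Rightarrow> bool" where
  "solves w u \<longleftrightarrow> u \<in> L2 D \<and> \<F> u = (\<lambda>k. drift u k + A_pow lam (-1) w k)"

text \<open>
  Banach's theorem needs points at distance zero to coincide, which fails for representatives in
  \<open>L\<^sup>2(D)\<close>.  The iteration therefore runs on coefficient sequences, with the Riesz--Fischer theorem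
  supplying a representative \<open>R c\<close> wherever the nonlinearity has to be evaluated.
\<close>

lemma solution_exists:
  assumes w: "w \<in> Hdot lam (\<beta> - 2)" and \<beta>: "0 \<le> \<beta>"
  shows "\<exists>u. solves w u"
proof -
  let ?H = "Hdot lam 0"
  interpret Metric_space ?H "\<lambda>b c. \<bar>Hdot_norm lam 0 (\<lambda>k. b k - c k)\<bar>"
    by (rule Hdot_Metric_space[OF lam_pos])
  have w0: "A_pow lam (-1) w \<in> ?H"
    unfolding A_pow_in_Hdot_iff by (rule Hdot_embedding(1)[OF lam_ge l_pos _ w]) (use \<beta> in simp)
  define R where "R c = (SOME u. u \<in> L2 D \<and> \<F> u = c)" for c
  have R: "R c \<in> L2 D" "\<F> (R c) = c" if "c \<in> ?H" for c
  proof -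
    have "lam k powr 0 = 1" for k using lam_pos[of k] by simp
    then have "summable (\<lambda>k. (c k)\<^sup>2)" using that by (simp add: Hdot_def)
    then have "\<exists>u. u \<in> L2 D \<and> \<F> u = c" using riesz_fischer[OF fin basis] by blast
    then have "R c \<in> L2 D \<and> \<F> (R c) = c" unfolding R_def by (rule someI_ex)
    then show "R c \<in> L2 D" "\<F> (R c) = c" by auto
  qed
  define \<Phi> where "\<Phi> c = (\<lambda>k. drift (R c) k + A_pow lam (-1) w k)" for c
  have \<Phi>: "\<Phi> \<in> ?H \<rightarrow> ?H"
    unfolding \<Phi>_def by (intro funcsetI Hdot_add drift_Hdot R w0) simp_all
  have contr: "\<bar>Hdot_norm lam 0 (\<lambda>k. \<Phi> b k - \<Phi> c k)\<bar> \<le> L / l * \<bar>Hdot_norm lam 0 (\<lambda>k. b k - c k)\<bar>"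
    if b: "b \<in> ?H" and c: "c \<in> ?H" for b c
  proof -
    have "Hdot_norm lam 0 (\<lambda>k. \<Phi> b k - \<Phi> c k) \<le>
        l powr ((0 - 2) / 2) * (L * L2_norm D (\<lambda>x. R b x - R c x))"
      unfolding \<Phi>_def add_diff_cancel_right by (intro drift_lipschitz R b c) simp
    also have "L2_norm D (\<lambda>x. R b x - R c x) = Hdot_norm lam 0 (\<lambda>k. b k - c k)"
      using \<F>_Hdot(2)[OF L2_diff[OF R(1)[OF b] R(1)[OF c]]]
      by (simp add: fourier_diff[OF basis R(1)[OF b] R(1)[OF c]] R(2) b c)
    also have "l powr ((0 - 2) / 2) = 1 / l"
      using l_pos by (simp add: powr_minus_divide)
    finally show ?thesis
      using Hdot_norm_nonneg[OF Hdot_diff[OF b c]] \<Phi> b c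
      by (simp add: Hdot_norm_nonneg Hdot_diff Pi_iff)
  qed
  have ne: "?H \<noteq> {}" using Hdot_zero by blast
  have "L / l < 1" using L_less l_pos by simp
  from Banach_fixedpoint_thm[OF Hdot_mcomplete[OF lam_pos] ne \<Phi> this contr]
  obtain c where c: "c \<in> ?H" "\<Phi> c = c" by blast
  then have "solves w (R c)"
    using R[OF c(1)] by (simp add: solves_def \<Phi>_def)
  then show ?thesis by blast
qed

text \<open>
  Subtracting the two equations gives \<open>\<parallel>u - v\<parallel> \<le> (L / l) \<parallel>u - v\<parallel> + \<parallel>A\<^sup>-\<^sup>1(w - z)\<parallel>\<close>; the first term is
  absorbed on the left.
\<close>

lemma solves_stable_L2:
  assumes u: "solves w u" and v: "solves z v" and w: "w \<in> Hdot lam (\<beta> - 2)" and z: "z \<in> Hdot lam (\<beta> - 2)"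
    and \<beta>: "0 \<le> \<beta>"
  shows "L2_norm D (\<lambda>x. u x - v x) \<le>
         l powr (- \<beta> / 2) / (1 - L / l) * Hdot_norm lam (\<beta> - 2) (\<lambda>k. w k - z k)"
proof -
  let ?n = "L2_norm D (\<lambda>x. u x - v x)"
  let ?A = "\<lambda>c. A_pow lam (-1) c"
  have uv: "u \<in> L2 D" "v \<in> L2 D" using u v by (auto simp: solves_def)
  have wz: "(\<lambda>k. w k - z k) \<in> Hdot lam (\<beta> - 2)" by (rule Hdot_diff[OF w z])
  have A: "?A (\<lambda>k. w k - z k) \<in> Hdot lam 0"
    unfolding A_pow_in_Hdot_iff by (rule Hdot_embedding(1)[OF lam_ge l_pos _ wz]) (use \<beta> in simp)
  have "?n = Hdot_norm lam 0 (\<lambda>k. \<F> u k - \<F> v k)"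
    using \<F>_Hdot(2)[OF L2_diff[OF uv]] by (simp add: fourier_diff[OF basis uv])
  also have "(\<lambda>k. \<F> u k - \<F> v k) = (\<lambda>k. (drift u k - drift v k) + ?A (\<lambda>k. w k - z k) k)"
    using u v by (auto simp: solves_def A_pow_def right_diff_distrib)
  also have "Hdot_norm lam 0 \<dots> \<le>
      Hdot_norm lam 0 (\<lambda>k. drift u k - drift v k) + Hdot_norm lam 0 (?A (\<lambda>k. w k - z k))"
    by (intro Hdot_norm_add A Hdot_diff drift_Hdot uv) simp_all
  also have "Hdot_norm lam 0 (\<lambda>k. drift u k - drift v k) \<le> l powr ((0 - 2) / 2) * (L * ?n)"
    by (intro drift_lipschitz uv) simp
  also have "l powr ((0 - 2) / 2) = 1 / l"
    using l_pos by (simp add: powr_minus_divide)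
  also have "Hdot_norm lam 0 (?A (\<lambda>k. w k - z k)) \<le>
      l powr ((- 2 - (\<beta> - 2)) / 2) * Hdot_norm lam (\<beta> - 2) (\<lambda>k. w k - z k)"
    using Hdot_embedding(2)[OF lam_ge l_pos _ wz, of "- 2"] \<beta> by (simp add: Hdot_norm_A_pow)
  finally have "(1 - L / l) * ?n \<le> l powr (- \<beta> / 2) * Hdot_norm lam (\<beta> - 2) (\<lambda>k. w k - z k)"
    by (simp add: algebra_simps)
  moreover have "1 - L / l > 0" using L_less l_pos by simp
  ultimately show ?thesis by (simp add: field_simps)
qed

lemma solves_unique:
  assumes u: "solves w u" and v: "solves w v" and w: "w \<in> Hdot lam (\<beta> - 2)" and \<beta>: "0 \<le> \<beta>"
  shows "AE x in lebesgue_on D. u x = v x"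
proof -
  have "L2_norm D (\<lambda>x. u x - v x) = 0"
    using solves_stable_L2[OF u v w w \<beta>] L2_norm_nonneg[of D "\<lambda>x. u x - v x"]
    by (simp add: Hdot_norm_def)
  moreover have "(\<lambda>x. u x - v x) \<in> L2 D"
    using u v by (auto simp: solves_def intro: L2_diff)
  ultimately show ?thesis
    using L2_norm_eq_0_AE by fastforce
qed

lemma solves_regular:
  assumes u: "solves w u" and w: "w \<in> Hdot lam (\<beta> - 2)" and \<beta>: "\<beta> \<le> 2"
  shows "\<F> u \<in> Hdot lam \<beta>"
  using u w \<beta> unfolding solves_def
  by (auto intro!: Hdot_add drift_Hdot simp: A_pow_in_Hdot_iff)

text \<open>
  Lipschitz constant of the solution operator into \<open>Hdot lam \<beta>\<close>: the drift contributes the first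
  summand, the term \<open>A\<^sup>-\<^sup>1 w\<close>, which depends isometrically on \<open>w\<close>, the summand \<open>1\<close>.
\<close>

definition stability_const :: "real \<Rightarrow> real" where
  "stability_const \<beta> = l powr ((\<beta> - 2) / 2) * (L * (l powr (- \<beta> / 2) / (1 - L / l))) + 1"

lemma stability_const_pos: "stability_const \<beta> > 0"
proof -
  have "1 - L / l > 0" using L_less l_pos by simp
  then have "l powr ((\<beta> - 2) / 2) * (L * (l powr (- \<beta> / 2) / (1 - L / l))) \<ge> 0"
    using L_nonneg by simp
  then show ?thesis by (simp add: stability_const_def)
qed

lemma solves_stable_Hdot:
  assumes u: "solves w u" and v: "solves z v" and w: "w \<in> Hdot lam (\<beta> - 2)" and z: "z \<in> Hdot lam (\<beta> - 2)"
    and \<beta>: "0 \<le> \<beta>" "\<beta> \<le> 2"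
  shows "Hdot_norm lam \<beta> (\<lambda>k. \<F> u k - \<F> v k) \<le>
         stability_const \<beta> * Hdot_norm lam (\<beta> - 2) (\<lambda>k. w k - z k)"
proof -
  let ?A = "\<lambda>c. A_pow lam (-1) c"
  have uv: "u \<in> L2 D" "v \<in> L2 D" using u v by (auto simp: solves_def)
  have wz: "(\<lambda>k. w k - z k) \<in> Hdot lam (\<beta> - 2)" by (rule Hdot_diff[OF w z])
  then have A: "?A (\<lambda>k. w k - z k) \<in> Hdot lam \<beta>"
    by (simp add: A_pow_in_Hdot_iff)
  have eq: "(\<lambda>k. \<F> u k - \<F> v k) = (\<lambda>k. (drift u k - drift v k) + ?A (\<lambda>k. w k - z k) k)"
    using u v by (auto simp: solves_def A_pow_def right_diff_distrib)
  have "Hdot_norm lam \<beta> (\<lambda>k. \<F> u k - \<F> v k) \<le>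
      Hdot_norm lam \<beta> (\<lambda>k. drift u k - drift v k) + Hdot_norm lam \<beta> (?A (\<lambda>k. w k - z k))"
    unfolding eq by (intro Hdot_norm_add A Hdot_diff drift_Hdot uv \<beta>)
  also have "Hdot_norm lam \<beta> (?A (\<lambda>k. w k - z k)) = Hdot_norm lam (\<beta> - 2) (\<lambda>k. w k - z k)"
    unfolding Hdot_norm_A_pow by simp
  also have "Hdot_norm lam \<beta> (\<lambda>k. drift u k - drift v k) \<le>
      l powr ((\<beta> - 2) / 2) * (L * L2_norm D (\<lambda>x. u x - v x))"
    by (intro drift_lipschitz uv \<beta>)
  also have "\<dots> \<le> l powr ((\<beta> - 2) / 2) * (L * (l powr (- \<beta> / 2) / (1 - L / l)
      * Hdot_norm lam (\<beta> - 2) (\<lambda>k. w k - z k)))"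
    by (intro mult_left_mono solves_stable_L2[OF u v w z \<beta>(1)] L_nonneg) simp
  finally show ?thesis
    by (simp add: stability_const_def distrib_right mult.assoc)
qed

definition sol :: "(nat \<Rightarrow> real) \<Rightarrow> 'a \<Rightarrow> real" where
  "sol w = (SOME u. solves w u)"

lemma sol_solves: "w \<in> Hdot lam (\<beta> - 2) \<Longrightarrow> 0 \<le> \<beta> \<Longrightarrow> solves w (sol w)"
  using someI_ex[OF solution_exists] by (simp add: sol_def)

lemma sol_measurable_L2:
  assumes \<beta>: "0 \<le> \<beta>"
  shows "sol \<in> measurable (Hdot_borel lam (\<beta> - 2)) (L2_borel D)"
  unfolding Hdot_borel_def L2_borel_def
proof (rule lipschitz_measurable_metric_borel)
  show "l powr (- \<beta> / 2) / (1 - L / l) > 0" using L_less l_pos by simp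
qed (use sol_solves \<beta> solves_stable_L2 in \<open>auto simp: solves_def\<close>)

lemma sol_measurable_Hdot:
  assumes \<beta>: "0 \<le> \<beta>" "\<beta> \<le> 2"
  shows "(\<lambda>w. \<F> (sol w)) \<in> measurable (Hdot_borel lam (\<beta> - 2)) (Hdot_borel lam \<beta>)"
  unfolding Hdot_borel_def
proof (rule lipschitz_measurable_metric_borel[OF _ stability_const_pos[of \<beta>]])
  fix w assume w: "w \<in> Hdot lam (\<beta> - 2)"
  show "\<F> (sol w) \<in> Hdot lam \<beta>"
    by (rule solves_regular[OF sol_solves[OF w \<beta>(1)] w \<beta>(2)])
  fix z assume z: "z \<in> Hdot lam (\<beta> - 2)"
  show "Hdot_norm lam \<beta> (\<lambda>k. \<F> (sol w) k - \<F> (sol z) k) \<le>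
      stability_const \<beta> * Hdot_norm lam (\<beta> - 2) (\<lambda>k. w k - z k)"
    by (rule solves_stable_Hdot[OF sol_solves[OF w \<beta>(1)] sol_solves[OF z \<beta>(1)] w z \<beta>])
qed

text \<open>
  The Lipschitz bound against the solution for zero noise.
\<close>

lemma sol_linear_growth:
  assumes w: "w \<in> Hdot lam (\<beta> - 2)" and \<beta>: "0 \<le> \<beta>" "\<beta> \<le> 2"
  shows "Hdot_norm lam \<beta> (\<F> (sol w)) \<le>
         stability_const \<beta> * Hdot_norm lam (\<beta> - 2) w + Hdot_norm lam \<beta> (\<F> (sol (\<lambda>k. 0)))"
proof -
  have s: "solves w (sol w)" "solves (\<lambda>k. 0) (sol (\<lambda>k. 0))"
    using sol_solves[OF w \<beta>(1)] sol_solves[OF Hdot_zero \<beta>(1)] by auto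
  have r: "\<F> (sol w) \<in> Hdot lam \<beta>" "\<F> (sol (\<lambda>k. 0)) \<in> Hdot lam \<beta>"
    using solves_regular[OF s(1) w \<beta>(2)] solves_regular[OF s(2) Hdot_zero \<beta>(2)] by auto
  show ?thesis
    using Hdot_norm_diff_abs[OF r] solves_stable_Hdot[OF s w Hdot_zero \<beta>] by simp
qed

end

section \<open>Moments of Gaussian series\<close>

text \<open>
  The moment of order \<open>2n\<close> of a standard normal variable, that is, \<open>(2n - 1)!!\<close>.
\<close>

definition normal_even_moment :: "nat \<Rightarrow> real" where
  "normal_even_moment n = fact (2 * n) / (2 ^ n * fact n)"

lemma normal_even_moment_nonneg: "normal_even_moment n \<ge> 0"
  by (simp add: normal_even_moment_def)

lemma (in prob_space) nn_integral_even_moment_normal: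
  assumes X: "distributed M lborel X (normal_density 0 \<sigma>)" and \<sigma>: "\<sigma> > 0"
  shows "(\<integral>\<^sup>+\<omega>. ennreal (X \<omega> ^ (2 * n)) \<partial>M) = ennreal (normal_even_moment n * (\<sigma>\<^sup>2) ^ n)"
proof -
  have "(\<integral>\<^sup>+\<omega>. ennreal (X \<omega> ^ (2 * n)) \<partial>M) =
      (\<integral>\<^sup>+x. ennreal (normal_density 0 \<sigma> x) * ennreal (x ^ (2 * n)) \<partial>lborel)"
    by (rule distributed_nn_integral[OF X, symmetric]) measurable
  also have "\<dots> = (\<integral>\<^sup>+x. ennreal (normal_density 0 \<sigma> x * (x - 0) ^ (2 * n)) \<partial>lborel)"
    by (simp add: ennreal_mult)
  also have "\<dots> = ennreal (fact (2 * n) / ((2 / \<sigma>\<^sup>2) ^ n * fact n))"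
  proof (rule nn_integral_eq_integral[THEN trans])
    show "integrable lborel (\<lambda>x. normal_density 0 \<sigma> x * (x - 0) ^ (2 * n))"
      using normal_moment_even[OF \<sigma>, of 0 n] by (rule integrable.intros)
    show "ennreal (\<integral>x. normal_density 0 \<sigma> x * (x - 0) ^ (2 * n) \<partial>lborel) =
        ennreal (fact (2 * n) / ((2 / \<sigma>\<^sup>2) ^ n * fact n))"
      by (subst integral_normal_moment_even[OF \<sigma>]) (rule refl)
  qed simp
  also have "fact (2 * n) / ((2 / \<sigma>\<^sup>2) ^ n * fact n) = normal_even_moment n * (\<sigma>\<^sup>2) ^ n"
    by (simp add: normal_even_moment_def power_divide)
  finally show ?thesis .
qed

text \<open>
  The sum is again normal, with variance \<open>\<Sum> a\<^sub>m\<^sup>2\<close>.  Vanishing coefficients are discarded because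
  a normal density requires a positive deviation.
\<close>

lemma (in prob_space) even_moment_gaussian_sum:
  fixes a :: "nat \<Rightarrow> real"
  assumes indep: "indep_vars (\<lambda>_. borel) eta UNIV"
    and normal: "\<And>m. distributed M lborel (eta m) std_normal_density"
  shows "(\<integral>\<^sup>+\<omega>. ennreal ((\<Sum>m<N. a m * eta m \<omega>) ^ (2 * n)) \<partial>M) \<le>
         ennreal (normal_even_moment n * (\<Sum>m<N. (a m)\<^sup>2) ^ n)"
proof -
  define I where "I = {m. m < N \<and> a m \<noteq> 0}"
  have I: "finite I" "I \<subseteq> {..<N}" by (auto simp: I_def)
  have sum1: "(\<Sum>m<N. a m * eta m \<omega>) = (\<Sum>m\<in>I. a m * eta m \<omega>)" for \<omega>
    by (rule sum.mono_neutral_right) (auto simp: I_def)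
  have sum2: "(\<Sum>m<N. (a m)\<^sup>2) = (\<Sum>m\<in>I. (a m)\<^sup>2)"
    by (rule sum.mono_neutral_right) (auto simp: I_def)
  show ?thesis
  proof (cases "I = {}")
    case True
    then show ?thesis
      by (cases n) (simp_all add: sum1 sum2 normal_even_moment_def emeasure_space_1)
  next
    case False
    have "indep_vars (\<lambda>_. borel) (\<lambda>m. (\<lambda>x. a m * x) \<circ> eta m) I"
      by (rule indep_vars_compose[OF indep_vars_subset[OF indep]]) auto
    then have ind: "indep_vars (\<lambda>_. borel) (\<lambda>m \<omega>. a m * eta m \<omega>) I"
      by (simp add: comp_def)
    have "distributed M lborel (\<lambda>\<omega>. a m * eta m \<omega>) (normal_density 0 \<bar>a m\<bar>)" if "m \<in> I" for m
      using normal_density_affine[OF normal, of "a m" 0 m] that by (simp add: I_def)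
    then have "distributed M lborel (\<lambda>\<omega>. \<Sum>m\<in>I. a m * eta m \<omega>)
        (normal_density (\<Sum>m\<in>I. 0) (sqrt (\<Sum>m\<in>I. \<bar>a m\<bar>\<^sup>2)))"
      by (intro sum_indep_normal I False ind) (auto simp: I_def)
    then have d: "distributed M lborel (\<lambda>\<omega>. \<Sum>m\<in>I. a m * eta m \<omega>)
        (normal_density 0 (sqrt (\<Sum>m\<in>I. (a m)\<^sup>2)))"
      by simp
    have pos: "(\<Sum>m\<in>I. (a m)\<^sup>2) > 0"
      using False I(1) by (intro sum_pos) (auto simp: I_def)
    show ?thesis
      using nn_integral_even_moment_normal[OF d, of n] pos by (simp add: sum1 sum2)
  qed
qed

text \<open>
  The moments of the partial sums are uniformly bounded, and a subsequence of the partial sums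
  converges almost surely; Fatou's lemma carries the bound over to the limit.
\<close>

lemma (in prob_space) even_moment_gaussian_limit:
  fixes a :: "nat \<Rightarrow> real"
  assumes indep: "indep_vars (\<lambda>_. borel) eta UNIV"
    and normal: "\<And>m. distributed M lborel (eta m) std_normal_density"
    and X[measurable]: "X \<in> borel_measurable M" and X2: "integrable M (\<lambda>\<omega>. (X \<omega>)\<^sup>2)"
    and lim: "(\<lambda>N. \<integral>\<^sup>+\<omega>. ennreal (((\<Sum>m<N. a m * eta m \<omega>) - X \<omega>)\<^sup>2) \<partial>M) \<longlonglongrightarrow> 0"
    and a: "\<And>N. (\<Sum>m<N. (a m)\<^sup>2) \<le> v"
  shows "(\<integral>\<^sup>+\<omega>. ennreal (X \<omega> ^ (2 * n)) \<partial>M) \<le> ennreal (normal_even_moment n * v ^ n)"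
proof -
  have [measurable]: "eta m \<in> borel_measurable M" for m
    using distributed_measurable[OF normal[of m]] by simp
  define Y where "Y N \<omega> = (\<Sum>m<N. a m * eta m \<omega>)" for N \<omega>
  have [measurable]: "Y N \<in> borel_measurable M" for N unfolding Y_def by measurable
  have moment: "(\<integral>\<^sup>+\<omega>. ennreal (Y N \<omega> ^ (2 * n)) \<partial>M) \<le> ennreal (normal_even_moment n * v ^ n)" for N n
  proof -
    have "(\<integral>\<^sup>+\<omega>. ennreal (Y N \<omega> ^ (2 * n)) \<partial>M) \<le> ennreal (normal_even_moment n * (\<Sum>m<N. (a m)\<^sup>2) ^ n)"
      unfolding Y_def by (rule even_moment_gaussian_sum[OF indep normal])
    also have "\<dots> \<le> ennreal (normal_even_moment n * v ^ n)"
      by (intro ennreal_leI mult_left_mono power_mono a normal_even_moment_nonneg sum_nonneg) simp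
    finally show ?thesis .
  qed
  have Y2: "integrable M (\<lambda>\<omega>. (Y N \<omega>)\<^sup>2)" for N
  proof (rule integrableI_bounded)
    have "(\<integral>\<^sup>+\<omega>. ennreal (norm ((Y N \<omega>)\<^sup>2)) \<partial>M) \<le> ennreal (normal_even_moment 1 * v ^ 1)"
      using moment[of N 1] by simp
    then show "(\<integral>\<^sup>+\<omega>. ennreal (norm ((Y N \<omega>)\<^sup>2)) \<partial>M) < \<infinity>"
      by (rule le_less_trans) simp
  qed measurable
  have d2: "integrable M (\<lambda>\<omega>. (Y N \<omega> - X \<omega>)\<^sup>2)" for N
  proof (rule Bochner_Integration.integrable_bound)
    show "integrable M (\<lambda>\<omega>. 2 * (Y N \<omega>)\<^sup>2 + 2 * (X \<omega>)\<^sup>2)" using X2 Y2 by simp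
    have "(y - x)\<^sup>2 \<le> 2 * y\<^sup>2 + 2 * x\<^sup>2" for x y :: real
      using zero_le_power2[of "y + x"] by (simp add: power2_eq_square algebra_simps)
    then show "AE \<omega> in M. norm ((Y N \<omega> - X \<omega>)\<^sup>2) \<le> norm (2 * (Y N \<omega>)\<^sup>2 + 2 * (X \<omega>)\<^sup>2)"
      by simp
  qed measurable
  have "(\<integral>\<^sup>+\<omega>. ennreal ((Y N \<omega> - X \<omega>)\<^sup>2) \<partial>M) = ennreal (\<integral>\<omega>. norm ((Y N \<omega> - X \<omega>)\<^sup>2) \<partial>M)" for N
    by (subst nn_integral_eq_integral[OF d2]) simp_all
  then have "(\<lambda>N. ennreal (\<integral>\<omega>. norm ((Y N \<omega> - X \<omega>)\<^sup>2) \<partial>M)) \<longlonglongrightarrow> ennreal 0"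
    using lim by (simp add: Y_def)
  then have "(\<lambda>N. \<integral>\<omega>. norm ((Y N \<omega> - X \<omega>)\<^sup>2) \<partial>M) \<longlonglongrightarrow> 0"
    by (rule tendsto_ennrealD) (auto intro!: always_eventually Bochner_Integration.integral_nonneg)
  from tendsto_L1_AE_subseq[OF d2 this]
  obtain r :: "nat \<Rightarrow> nat" where r: "AE \<omega> in M. (\<lambda>i. (Y (r i) \<omega> - X \<omega>)\<^sup>2) \<longlonglongrightarrow> 0" by blast
  have "(\<integral>\<^sup>+\<omega>. ennreal (X \<omega> ^ (2 * n)) \<partial>M) = (\<integral>\<^sup>+\<omega>. liminf (\<lambda>i. ennreal (Y (r i) \<omega> ^ (2 * n))) \<partial>M)"
  proof (rule nn_integral_cong_AE, use r in eventually_elim)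
    case (elim \<omega>)
    then have "(\<lambda>i. sqrt ((Y (r i) \<omega> - X \<omega>)\<^sup>2)) \<longlonglongrightarrow> sqrt 0" by (intro tendsto_intros)
    then have "(\<lambda>i. Y (r i) \<omega>) \<longlonglongrightarrow> X \<omega>"
      by (simp add: tendsto_rabs_zero_iff LIM_zero_iff)
    then have "(\<lambda>i. ennreal (Y (r i) \<omega> ^ (2 * n))) \<longlonglongrightarrow> ennreal (X \<omega> ^ (2 * n))"
      by (intro tendsto_intros)
    then show ?case using lim_imp_Liminf[OF sequentially_bot] by metis
  qed
  also have "\<dots> \<le> liminf (\<lambda>i. \<integral>\<^sup>+\<omega>. ennreal (Y (r i) \<omega> ^ (2 * n)) \<partial>M)"
    by (rule nn_integral_liminf) measurable
  also have "\<dots> \<le> liminf (\<lambda>i. ennreal (normal_even_moment n * v ^ n))"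
    by (rule Liminf_mono) (simp add: moment)
  also have "\<dots> = ennreal (normal_even_moment n * v ^ n)" by (simp add: Liminf_const)
  finally show ?thesis .
qed

lemma power_convex_nonneg: "convex_on {0::real..} (\<lambda>x. x ^ n)"
  by (cases "even n") (auto intro: convex_on_subset[OF convex_power_even] convex_power_odd)

text \<open>
  With \<open>S = \<Sum> b\<^sub>k v\<^sub>k\<close>, write \<open>\<Sum> b\<^sub>k Y\<^sub>k\<close> as the average of the variables \<open>S Y\<^sub>k / v\<^sub>k\<close> with the
  probability weights \<open>b\<^sub>k v\<^sub>k / S\<close> and apply Jensen's inequality to the \<open>n\<close>th power.  Each
  \<open>(S Y\<^sub>k / v\<^sub>k)\<^sup>n\<close> has integral at most \<open>G S\<^sup>n\<close>, and so has the average.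
\<close>

lemma nn_integral_power_weighted_sum:
  fixes b v :: "'i \<Rightarrow> real" and Y :: "'i \<Rightarrow> 'w \<Rightarrow> real"
  assumes fin: "finite K" and n: "n \<ge> 1"
    and b: "\<And>k. b k \<ge> 0" and v: "\<And>k. v k \<ge> 0" and G: "G \<ge> 0"
    and Ym[measurable]: "\<And>k. Y k \<in> borel_measurable M" and Y0: "\<And>k \<omega>. Y k \<omega> \<ge> 0"
    and Y: "\<And>k. (\<integral>\<^sup>+\<omega>. ennreal (Y k \<omega> ^ n) \<partial>M) \<le> ennreal (G * v k ^ n)"
  shows "(\<integral>\<^sup>+\<omega>. ennreal ((\<Sum>k\<in>K. b k * Y k \<omega>) ^ n) \<partial>M) \<le> ennreal (G * (\<Sum>k\<in>K. b k * v k) ^ n)"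
proof -
  define I where "I = {k\<in>K. b k * v k > 0}"
  have finI: "finite I" using fin by (simp add: I_def)
  define S where "S = (\<Sum>k\<in>I. b k * v k)"
  have S: "(\<Sum>k\<in>K. b k * v k) = S"
    unfolding S_def using fin b v
    by (intro sum.mono_neutral_right) (auto simp: I_def less_le)
  \<comment> \<open>Indices with \<open>v k = 0\<close> cannot be rescaled, but there \<open>Y k\<close> vanishes almost everywhere.\<close>
  have vanish: "AE \<omega> in M. v k = 0 \<longrightarrow> Y k \<omega> = 0" for k
  proof (cases "v k = 0")
    case True
    then have "(\<integral>\<^sup>+\<omega>. ennreal (Y k \<omega> ^ n) \<partial>M) = 0" using Y[of k] n by (simp add: zero_power)
    then have "AE \<omega> in M. ennreal (Y k \<omega> ^ n) = 0"
      by (subst (asm) nn_integral_0_iff_AE) auto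
    then show ?thesis
      using n by eventually_elim (simp add: ennreal_eq_0_iff Y0, metis Y0 power_eq_0_iff power_le_zero_eq order_antisym)
  qed simp
  have "AE \<omega> in M. \<forall>k\<in>K. v k = 0 \<longrightarrow> Y k \<omega> = 0"
    using fin vanish by (intro AE_finite_allI) auto
  then have sumI: "AE \<omega> in M. (\<Sum>k\<in>K. b k * Y k \<omega>) = (\<Sum>k\<in>I. b k * Y k \<omega>)"
  proof eventually_elim
    case (elim \<omega>)
    then show ?case
      using fin b v by (intro sum.mono_neutral_right) (auto simp: I_def less_le)
  qed
  show ?thesis
  proof (cases "I = {}")
    case True
    have "AE \<omega> in M. ennreal ((\<Sum>k\<in>K. b k * Y k \<omega>) ^ n) = 0"
      using sumI by eventually_elim (use True n in simp)
    then have "(\<integral>\<^sup>+\<omega>. ennreal ((\<Sum>k\<in>K. b k * Y k \<omega>) ^ n) \<partial>M) = 0"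
      by (subst nn_integral_0_iff_AE) auto
    then show ?thesis by simp
  next
    case False
    have Spos: "S > 0" unfolding S_def using False finI by (intro sum_pos) (auto simp: I_def)
    have vpos: "v k > 0" "b k > 0" if "k \<in> I" for k
      using that b[of k] v[of k] by (auto simp: I_def zero_less_mult_iff)
    let ?w = "\<lambda>k. b k * v k / S * (S / v k) ^ n"
    have w: "?w k \<ge> 0" if "k \<in> I" for k using vpos[OF that] Spos by simp
    have jensen: "(\<Sum>k\<in>I. b k * Y k \<omega>) ^ n \<le> (\<Sum>k\<in>I. ?w k * Y k \<omega> ^ n)" for \<omega>
    proof -
      have "(\<Sum>k\<in>I. b k * Y k \<omega>) = (\<Sum>k\<in>I. (b k * v k / S) *\<^sub>R (S / v k * Y k \<omega>))"
        using vpos Spos by (intro sum.cong) (auto simp: less_imp_neq[symmetric])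
      also have "\<dots> ^ n \<le> (\<Sum>k\<in>I. (b k * v k / S) * (S / v k * Y k \<omega>) ^ n)"
      proof (rule convex_on_sum[OF finI False power_convex_nonneg])
        show "(\<Sum>k\<in>I. b k * v k / S) = 1"
          using Spos by (simp add: S_def flip: sum_divide_distrib)
      qed (use v b Spos Y0 in \<open>auto simp: less_imp_le\<close>)
      also have "\<dots> = (\<Sum>k\<in>I. ?w k * Y k \<omega> ^ n)"
        by (simp only: power_mult_distrib mult.assoc)
      finally show ?thesis .
    qed
    have "(\<integral>\<^sup>+\<omega>. ennreal ((\<Sum>k\<in>K. b k * Y k \<omega>) ^ n) \<partial>M) \<le> (\<integral>\<^sup>+\<omega>. (\<Sum>k\<in>I. ennreal (?w k) * ennreal (Y k \<omega> ^ n)) \<partial>M)"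
    proof (rule nn_integral_mono_AE, use sumI in eventually_elim)
      case (elim \<omega>)
      have "ennreal ((\<Sum>k\<in>I. b k * Y k \<omega>) ^ n) \<le> ennreal (\<Sum>k\<in>I. ?w k * Y k \<omega> ^ n)"
        by (rule ennreal_leI[OF jensen])
      also have "\<dots> = (\<Sum>k\<in>I. ennreal (?w k * Y k \<omega> ^ n))"
        by (rule sum_ennreal[symmetric]) (intro mult_nonneg_nonneg w zero_le_power Y0)
      also have "\<dots> = (\<Sum>k\<in>I. ennreal (?w k) * ennreal (Y k \<omega> ^ n))"
        by (intro sum.cong refl ennreal_mult w zero_le_power Y0)
      finally show ?case using elim by simp
    qed
    also have "\<dots> = (\<Sum>k\<in>I. ennreal (?w k) * (\<integral>\<^sup>+\<omega>. ennreal (Y k \<omega> ^ n) \<partial>M))"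
      by (subst nn_integral_sum) (auto intro!: sum.cong nn_integral_cmult)
    also have "\<dots> \<le> (\<Sum>k\<in>I. ennreal (?w k) * ennreal (G * v k ^ n))"
      by (intro sum_mono mult_left_mono Y) simp
    also have "\<dots> = (\<Sum>k\<in>I. ennreal (?w k * (G * v k ^ n)))"
      using G vpos by (intro sum.cong refl ennreal_mult[symmetric] w mult_nonneg_nonneg zero_le_power) (auto intro: less_imp_le)
    also have "\<dots> = ennreal (\<Sum>k\<in>I. ?w k * (G * v k ^ n))"
      using G vpos by (intro sum_ennreal mult_nonneg_nonneg w zero_le_power) (auto intro: less_imp_le)
    also have "(\<Sum>k\<in>I. ?w k * (G * v k ^ n)) = (\<Sum>k\<in>I. b k * v k * (G * S ^ n / S))"
    proof (rule sum.cong)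
      fix k assume "k \<in> I"
      then have "v k \<noteq> 0" using vpos by force
      then show "?w k * (G * v k ^ n) = b k * v k * (G * S ^ n / S)"
        by (simp add: power_divide)
    qed simp
    also have "\<dots> = S * (G * S ^ n / S)"
      by (simp only: S_def sum_distrib_right)
    also have "\<dots> = G * S ^ n" using Spos by simp
    finally show ?thesis by (simp add: S)
  qed
qed

text \<open>
  Combines the moment bound for each coordinate with Jensen's inequality over finitely many
  coordinates.  The resulting bound depends only on the Hilbert--Schmidt sum \<open>B\<close>, so Fatou's lemma
  extends it to all coordinates.
\<close>

lemma (in prob_space) gaussian_series_even_moments:
  fixes a :: "nat \<Rightarrow> nat \<Rightarrow> real"
  assumes indep: "indep_vars (\<lambda>_. borel) eta UNIV"
    and normal: "\<And>m. distributed M lborel (eta m) std_normal_density"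
    and lam_pos: "\<And>k. lam k > 0"
    and hs: "(\<Sum>m. \<Sum>k. ennreal (lam k powr s * (a m k)\<^sup>2)) < \<infinity>"
    and W: "W \<in> measurable M (Hdot_borel lam s)"
    and W2: "integrable M (\<lambda>\<omega>. (Hdot_norm lam s (W \<omega>))\<^sup>2)"
    and lim: "(\<lambda>N. \<integral>\<^sup>+\<omega>. ennreal ((Hdot_norm lam s (\<lambda>k. (\<Sum>m<N. a m k * eta m \<omega>) - W \<omega> k))\<^sup>2) \<partial>M) \<longlonglongrightarrow> 0"
    and n: "n \<ge> 1"
  shows "integrable M (\<lambda>\<omega>. Hdot_norm lam s (W \<omega>) ^ (2 * n))"
proof -
  let ?b = "\<lambda>k. lam k powr s"
  have b_pos: "?b k > 0" for k using lam_pos[of k] by simp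
  have [measurable]: "eta m \<in> borel_measurable M" for m
    using distributed_measurable[OF normal[of m]] by simp
  have W_space: "W \<omega> \<in> Hdot lam s" if "\<omega> \<in> space M" for \<omega>
    using measurable_space[OF W that] by (simp add: Hdot_borel_def space_metric_borel)
  have Wk[measurable]: "(\<lambda>\<omega>. W \<omega> k) \<in> borel_measurable M" for k
    by (rule measurable_compose[OF W Hdot_coeff_measurable[OF lam_pos]])
  have Wn[measurable]: "(\<lambda>\<omega>. Hdot_norm lam s (W \<omega>)) \<in> borel_measurable M"
    by (rule measurable_compose[OF W Hdot_norm_measurable])

  define B where "B = enn2real (\<Sum>m. \<Sum>k. ennreal (?b k * (a m k)\<^sup>2))"
  have B: "(\<Sum>m. \<Sum>k. ennreal (?b k * (a m k)\<^sup>2)) = ennreal B" "B \<ge> 0"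
    using hs by (simp_all add: B_def)
  \<comment> \<open>Finite rectangles of the double series suffice: they bound the column sums \<open>v k\<close> and \<open>\<Sum>\<^sub>k \<lambda>\<^sub>k\<^sup>s v\<^sub>k\<close> without interchanging infinite sums.\<close>
  have double: "(\<Sum>m<N. \<Sum>k<K. ?b k * (a m k)\<^sup>2) \<le> B" for N K
  proof -
    have "ennreal (\<Sum>m<N. \<Sum>k<K. ?b k * (a m k)\<^sup>2) = (\<Sum>m<N. \<Sum>k<K. ennreal (?b k * (a m k)\<^sup>2))"
      by (simp add: sum_nonneg flip: sum_ennreal)
    also have "\<dots> \<le> (\<Sum>m<N. \<Sum>k. ennreal (?b k * (a m k)\<^sup>2))"
      by (intro sum_mono sum_le_suminf) auto
    also have "\<dots> \<le> (\<Sum>m. \<Sum>k. ennreal (?b k * (a m k)\<^sup>2))"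
      by (intro sum_le_suminf) auto
    finally show ?thesis using B by simp
  qed
  have aH: "a m \<in> Hdot lam s" for m
  proof -
    have "(\<Sum>k. ennreal (?b k * (a m k)\<^sup>2)) < \<infinity>"
      using ennreal_suminf_lessD[OF hs] by simp
    then show ?thesis
      unfolding Hdot_def by (auto intro!: summable_suminf_not_top)
  qed
  have col_le: "(\<Sum>m<N. (a m k)\<^sup>2) \<le> B / ?b k" for N k
  proof -
    have "(\<Sum>m<N. ?b k * (a m k)\<^sup>2) \<le> (\<Sum>m<N. \<Sum>j<Suc k. ?b j * (a m j)\<^sup>2)"
      by (intro sum_mono member_le_sum) auto
    also have "\<dots> \<le> B" by (rule double)
    finally show ?thesis
      using b_pos[of k] by (simp add: field_simps flip: sum_distrib_left)
  qed
  have col: "summable (\<lambda>m. (a m k)\<^sup>2)" for k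
    by (rule summableI_nonneg_bounded[OF _ col_le]) simp
  define v where "v k = (\<Sum>m. (a m k)\<^sup>2)" for k
  have v0: "v k \<ge> 0" for k unfolding v_def by (rule suminf_nonneg[OF col]) simp
  have v_le: "(\<Sum>m<N. (a m k)\<^sup>2) \<le> v k" for N k
    unfolding v_def by (rule sum_le_suminf[OF col]) auto
  have vB: "(\<Sum>k<K. ?b k * v k) \<le> B" for K
  proof (rule LIMSEQ_le_const2)
    show "(\<lambda>N. \<Sum>k<K. ?b k * (\<Sum>m<N. (a m k)\<^sup>2)) \<longlonglongrightarrow> (\<Sum>k<K. ?b k * v k)"
      unfolding v_def by (intro tendsto_intros summable_LIMSEQ col)
    have "(\<Sum>k<K. ?b k * (\<Sum>m<N. (a m k)\<^sup>2)) \<le> B" for N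
      using double[of K N] sum.swap[of "\<lambda>k m. ?b k * (a m k)\<^sup>2" "{..<N}" "{..<K}"]
      by (simp add: sum_distrib_left)
    then show "\<exists>N0. \<forall>N\<ge>N0. (\<Sum>k<K. ?b k * (\<Sum>m<N. (a m k)\<^sup>2)) \<le> B" by blast
  qed

  have coord: "(\<integral>\<^sup>+\<omega>. ennreal (W \<omega> k ^ (2 * n)) \<partial>M) \<le> ennreal (normal_even_moment n * v k ^ n)" for k
  proof (rule even_moment_gaussian_limit[OF indep normal Wk _ _ v_le])
    have sq: "(c k)\<^sup>2 \<le> 1 / ?b k * (Hdot_norm lam s c)\<^sup>2" if "c \<in> Hdot lam s" for c
    proof -
      have "(lam k powr (s / 2) * \<bar>c k\<bar>)\<^sup>2 \<le> (Hdot_norm lam s c)\<^sup>2"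
        by (intro power_mono Hdot_coeff_le that) simp
      then have "?b k * (c k)\<^sup>2 \<le> (Hdot_norm lam s c)\<^sup>2"
        by (simp add: powr_mult_square power_mult_distrib)
      then show ?thesis using b_pos[of k] by (simp add: field_simps)
    qed
    show "integrable M (\<lambda>\<omega>. (W \<omega> k)\<^sup>2)"
    proof (rule Bochner_Integration.integrable_bound)
      show "integrable M (\<lambda>\<omega>. 1 / ?b k * (Hdot_norm lam s (W \<omega>))\<^sup>2)"
        using W2 by (rule integrable_mult_right)
      show "AE \<omega> in M. norm ((W \<omega> k)\<^sup>2) \<le> norm (1 / ?b k * (Hdot_norm lam s (W \<omega>))\<^sup>2)"
        using sq[OF W_space] by (intro AE_I2) (simp add: abs_mult)
    qed measurable
    let ?R = "\<lambda>N \<omega> k. (\<Sum>m<N. a m k * eta m \<omega>) - W \<omega> k"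
    have RH: "?R N \<omega> \<in> Hdot lam s" if "\<omega> \<in> space M" for N \<omega>
    proof -
      have "(\<lambda>k. \<Sum>m<N. a m k * eta m \<omega>) \<in> Hdot lam s"
      proof (induction N)
        case 0
        then show ?case by (simp add: Hdot_zero)
      next
        case (Suc N)
        have "summable (\<lambda>k. (eta N \<omega>)\<^sup>2 * (?b k * (a N k)\<^sup>2))"
          using aH[of N] by (intro summable_mult) (simp add: Hdot_def)
        then have "(\<lambda>k. a N k * eta N \<omega>) \<in> Hdot lam s"
          by (simp add: Hdot_def power_mult_distrib mult_ac)
        from Hdot_add[OF Suc this] show ?case by simp
      qed
      from Hdot_diff[OF this W_space[OF that]] show ?thesis .
    qed
    have Rm[measurable]: "(\<lambda>\<omega>. Hdot_norm lam s (?R N \<omega>)) \<in> borel_measurable M" for N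
      unfolding Hdot_norm_def by measurable
    have le: "(\<integral>\<^sup>+\<omega>. ennreal ((?R N \<omega> k)\<^sup>2) \<partial>M) \<le>
        ennreal (1 / ?b k) * (\<integral>\<^sup>+\<omega>. ennreal ((Hdot_norm lam s (?R N \<omega>))\<^sup>2) \<partial>M)" for N
    proof -
      have "(\<integral>\<^sup>+\<omega>. ennreal ((?R N \<omega> k)\<^sup>2) \<partial>M) \<le>
          (\<integral>\<^sup>+\<omega>. ennreal (1 / ?b k) * ennreal ((Hdot_norm lam s (?R N \<omega>))\<^sup>2) \<partial>M)"
      proof (rule nn_integral_mono)
        fix \<omega> assume "\<omega> \<in> space M"
        from sq[OF RH[OF this, of N]]
        have "ennreal ((?R N \<omega> k)\<^sup>2) \<le> ennreal (1 / ?b k * (Hdot_norm lam s (?R N \<omega>))\<^sup>2)"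
          by (rule ennreal_leI)
        then show "ennreal ((?R N \<omega> k)\<^sup>2) \<le> ennreal (1 / ?b k) * ennreal ((Hdot_norm lam s (?R N \<omega>))\<^sup>2)"
          by (subst ennreal_mult[symmetric]) simp_all
      qed
      also have "\<dots> = ennreal (1 / ?b k) * (\<integral>\<^sup>+\<omega>. ennreal ((Hdot_norm lam s (?R N \<omega>))\<^sup>2) \<partial>M)"
        by (rule nn_integral_cmult) measurable
      finally show ?thesis .
    qed
    have "(\<lambda>N. ennreal (1 / ?b k) * (\<integral>\<^sup>+\<omega>. ennreal ((Hdot_norm lam s (?R N \<omega>))\<^sup>2) \<partial>M)) \<longlonglongrightarrow> ennreal (1 / ?b k) * 0"
      by (rule ennreal_tendsto_cmult[OF _ lim]) simp
    then have lim0: "(\<lambda>N. ennreal (1 / ?b k) * (\<integral>\<^sup>+\<omega>. ennreal ((Hdot_norm lam s (?R N \<omega>))\<^sup>2) \<partial>M)) \<longlonglongrightarrow> 0"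
      by simp
    show "(\<lambda>N. \<integral>\<^sup>+\<omega>. ennreal ((?R N \<omega> k)\<^sup>2) \<partial>M) \<longlonglongrightarrow> 0"
      by (rule tendsto_sandwich[OF _ _ tendsto_const lim0]) (simp_all add: le)
  qed

  have partial: "(\<integral>\<^sup>+\<omega>. ennreal ((\<Sum>k<K. ?b k * (W \<omega> k)\<^sup>2) ^ n) \<partial>M) \<le> ennreal (normal_even_moment n * B ^ n)" for K
  proof -
    have "(\<integral>\<^sup>+\<omega>. ennreal ((\<Sum>k<K. ?b k * (W \<omega> k)\<^sup>2) ^ n) \<partial>M) \<le>
        ennreal (normal_even_moment n * (\<Sum>k<K. ?b k * v k) ^ n)"
      by (rule nn_integral_power_weighted_sum[OF _ n])
        (use coord in \<open>simp_all add: v0 normal_even_moment_nonneg flip: power_mult\<close>)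
    also have "\<dots> \<le> ennreal (normal_even_moment n * B ^ n)"
      by (intro ennreal_leI mult_left_mono power_mono vB sum_nonneg mult_nonneg_nonneg v0 normal_even_moment_nonneg) simp_all
    finally show ?thesis .
  qed
  have "(\<integral>\<^sup>+\<omega>. ennreal (Hdot_norm lam s (W \<omega>) ^ (2 * n)) \<partial>M) =
      (\<integral>\<^sup>+\<omega>. liminf (\<lambda>K. ennreal ((\<Sum>k<K. ?b k * (W \<omega> k)\<^sup>2) ^ n)) \<partial>M)"
  proof (rule nn_integral_cong)
    fix \<omega> assume \<omega>: "\<omega> \<in> space M"
    have "(\<lambda>K. ennreal ((\<Sum>k<K. ?b k * (W \<omega> k)\<^sup>2) ^ n)) \<longlonglongrightarrow> ennreal ((\<Sum>k. ?b k * (W \<omega> k)\<^sup>2) ^ n)"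
      using W_space[OF \<omega>] by (intro tendsto_intros summable_LIMSEQ) (simp add: Hdot_def)
    then show "ennreal (Hdot_norm lam s (W \<omega>) ^ (2 * n)) = liminf (\<lambda>K. ennreal ((\<Sum>k<K. ?b k * (W \<omega> k)\<^sup>2) ^ n))"
      using lim_imp_Liminf[OF sequentially_bot] by (metis Hdot_norm_power2[OF W_space[OF \<omega>]] power_mult)
  qed
  also have "\<dots> \<le> liminf (\<lambda>K. \<integral>\<^sup>+\<omega>. ennreal ((\<Sum>k<K. ?b k * (W \<omega> k)\<^sup>2) ^ n) \<partial>M)"
    by (rule nn_integral_liminf) measurable
  also have "\<dots> \<le> liminf (\<lambda>K. ennreal (normal_even_moment n * B ^ n))"
    by (rule Liminf_mono) (simp add: partial)
  also have "\<dots> < \<infinity>" by (simp add: Liminf_const)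
  finally have "(\<integral>\<^sup>+\<omega>. ennreal (Hdot_norm lam s (W \<omega>) ^ (2 * n)) \<partial>M) < \<infinity>" .
  then show ?thesis
    by (intro integrableI_bounded) (simp_all add: power_abs power_mult)
qed

section \<open>Existence and uniqueness of the mild solution\<close>

lemma add_power_le: "(a + b) ^ n \<le> 2 ^ n * (a ^ n + b ^ n)" if "a \<ge> 0" "b \<ge> 0" for a b :: real
proof -
  have "(a + b) ^ n \<le> (2 * max a b) ^ n"
    using that by (intro power_mono) auto
  also have "\<dots> = 2 ^ n * max a b ^ n" by (simp add: power_mult_distrib)
  also have "max a b ^ n \<le> a ^ n + b ^ n"
    using that by (auto simp: max_def)
  finally show ?thesis by simp
qed

lemma integrable_powr_of_linear_growth:
  fixes h x :: "'w \<Rightarrow> real"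
  assumes "finite_measure M"
    and [measurable]: "h \<in> borel_measurable M" "x \<in> borel_measurable M"
    and h: "\<And>\<omega>. \<omega> \<in> space M \<Longrightarrow> 0 \<le> h \<omega> \<and> h \<omega> \<le> C * x \<omega> + C'"
    and x: "\<And>\<omega>. \<omega> \<in> space M \<Longrightarrow> 0 \<le> x \<omega>" and C: "C \<ge> 0" "C' \<ge> 0"
    and pn: "0 \<le> p" "p \<le> real n" and int: "integrable M (\<lambda>\<omega>. x \<omega> ^ n)"
  shows "integrable M (\<lambda>\<omega>. h \<omega> powr p)"
proof -
  interpret finite_measure M by fact
  let ?g = "\<lambda>\<omega>. 2 ^ n * ((1 + C') ^ n + C ^ n * x \<omega> ^ n)"
  have "integrable M ?g" using int by simp
  moreover have "(\<lambda>\<omega>. h \<omega> powr p) \<in> borel_measurable M" by measurable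
  moreover have "AE \<omega> in M. norm (h \<omega> powr p) \<le> norm (?g \<omega>)"
  proof (rule AE_I2)
    fix \<omega> assume \<omega>: "\<omega> \<in> space M"
    have "h \<omega> powr p \<le> (1 + h \<omega>) powr p"
      using h[OF \<omega>] pn by (intro powr_mono2) auto
    also have "\<dots> \<le> (1 + h \<omega>) powr real n"
      using h[OF \<omega>] pn by (intro powr_mono) auto
    also have "\<dots> = (1 + h \<omega>) ^ n"
      using h[OF \<omega>] by (intro powr_realpow) auto
    also have "\<dots> \<le> ((1 + C') + C * x \<omega>) ^ n"
      using h[OF \<omega>] by (intro power_mono) auto
    also have "\<dots> \<le> ?g \<omega>"
      using add_power_le[of "1 + C'" "C * x \<omega>" n] C x[OF \<omega>] by (simp add: power_mult_distrib)
    finally show "norm (h \<omega> powr p) \<le> norm (?g \<omega>)" by simp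
  qed
  ultimately show ?thesis by (rule Bochner_Integration.integrable_bound)
qed

theorem theorem2p1:
  fixes M :: "'w measure"
    and D :: "'a::euclidean_space set"
    and lam :: "nat \<Rightarrow> real" and phi :: "nat \<Rightarrow> 'a \<Rightarrow> real"
    and Q Qh :: "('a \<Rightarrow> real) \<Rightarrow> ('a \<Rightarrow> real)"
    and sigma :: "nat \<Rightarrow> real" and psi :: "nat \<Rightarrow> 'a \<Rightarrow> real"
    and eta :: "nat \<Rightarrow> 'w \<Rightarrow> real" and W :: "'w \<Rightarrow> nat \<Rightarrow> real"
    and f :: "real \<Rightarrow> real" and p \<beta> \<gamma> :: real
  assumes prob: "prob_space M"
    and domain: "open D" "connected D" "D \<noteq> {}" "bounded D" "piecewise_smooth_boundary D"
    and eigen: "dirichlet_eigensystem D lam phi"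
    and covariance: "L2_nonneg_selfadjoint D Q" "L2_orthonormal_basis D psi"
      "\<And>m. AE x in lebesgue_on D. Q (psi m) x = sigma m * psi m x"
      "L2_operator_sqrt D Q Qh"
    and gauss: "prob_space.indep_vars M (\<lambda>_. borel) eta UNIV"
      "\<And>m. distributed M lborel (eta m) std_normal_density"
    and p: "p \<ge> 1"
    and poincare: "\<gamma> > 0" "\<And>v. v \<in> H10 D \<Longrightarrow> grad_inner D v v \<ge> \<gamma> * (L2_norm D v)\<^sup>2"
    and lipschitz: "\<exists>L. L-lipschitz_on UNIV f" "Lip_norm f < \<gamma>"
    and beta: "\<beta> \<in> {0..2}"
    and hs: "L20_norm_sq D phi Qh psi (A_pow lam ((\<beta> - 2) / 2)) < \<infinity>"
    and noise: "is_noise M D lam phi Qh psi eta (\<beta> - 2) W"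
  shows "\<exists>u. mild_solution M D lam phi f W u \<and>
             (\<lambda>\<omega>. fourier D phi (u \<omega>)) \<in> Lp_Hdot M p lam \<beta> \<and>
             (\<forall>v. mild_solution M D lam phi f W v \<and>
                  (\<lambda>\<omega>. fourier D phi (v \<omega>)) \<in> Lp_Hdot M p lam \<beta> \<longrightarrow>
                  (AE \<omega> in M. AE x in lebesgue_on D. v \<omega> x = u \<omega> x))"
proof -
  interpret prob_space M by (rule prob)
  have \<beta>: "0 \<le> \<beta>" "\<beta> \<le> 2" using beta by auto
  have basis: "L2_orthonormal_basis D phi"
    using eigen by (simp add: dirichlet_eigensystem_def)
  interpret semilinear_dirichlet D lam phi f \<gamma> "Lip_norm f"
  proof (rule semilinear_dirichlet.intro)
    show "finite_measure (lebesgue_on D)"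
      by (intro finite_measure_lebesgue_on lmeasurable_open domain)
    show "L2_orthonormal_basis D phi" by (rule basis)
    show "\<gamma> \<le> lam k" for k by (rule eigenvalue_ge_poincare[OF eigen poincare(2)])
    show "\<bar>f x - f y\<bar> \<le> Lip_norm f * \<bar>x - y\<bar>" "0 \<le> Lip_norm f" for x y
      using lipschitz(1) Lip_norm_bound by blast+
    show "Lip_norm f < \<gamma>" by (rule lipschitz(2))
  qed
  let ?s = "\<beta> - 2"
  have W: "W \<in> measurable M (Hdot_borel lam ?s)"
    using noise by (simp add: is_noise_def Lp_Hdot_def)
  have WH: "W \<omega> \<in> Hdot lam ?s" if "\<omega> \<in> space M" for \<omega>
    using measurable_space[OF W that] by (simp add: Hdot_borel_def space_metric_borel)
  define u where "u \<omega> = sol (W \<omega>)" for \<omega>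
  have u: "solves (W \<omega>) (u \<omega>)" if "\<omega> \<in> space M" for \<omega>
    unfolding u_def by (rule sol_solves[OF WH[OF that] \<beta>(1)])

  have "mild_solution M D lam phi f W u"
    unfolding mild_solution_def
  proof
    show "u \<in> measurable M (L2_borel D)"
      unfolding u_def by (rule measurable_compose[OF W sol_measurable_L2[OF \<beta>(1)]])
    show "AE \<omega> in M. \<F> (u \<omega>) = (\<lambda>k. A_pow lam (-1) (\<F> (\<lambda>x. f (u \<omega> x))) k + A_pow lam (-1) (W \<omega>) k)"
      using u by (intro AE_I2) (simp add: solves_def drift_def)
  qed
  moreover have "(\<lambda>\<omega>. \<F> (u \<omega>)) \<in> Lp_Hdot M p lam \<beta>"
  proof -
    have um: "(\<lambda>\<omega>. \<F> (u \<omega>)) \<in> measurable M (Hdot_borel lam \<beta>)"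
      unfolding u_def by (rule measurable_compose[OF W sol_measurable_Hdot[OF \<beta>]])
    \<comment> \<open>An even integer exponent \<open>2 n \<ge> p\<close>, for which Gaussian moments are explicit.\<close>
    define n where "n = nat \<lceil>p\<rceil>"
    have n: "n \<ge> 1" "p \<le> real n" using p by (auto simp: n_def) linarith+
    have "integrable M (\<lambda>\<omega>. Hdot_norm lam ?s (W \<omega>) ^ (2 * n))"
    proof (rule gaussian_series_even_moments[OF gauss lam_pos _ W _ _ n(1)])
      have "(A_pow lam (?s / 2) c k)\<^sup>2 = lam k powr ?s * (c k)\<^sup>2" for c k
        by (simp only: A_pow_def powr_mult_square)
      then show "(\<Sum>m. \<Sum>k. ennreal (lam k powr ?s * (\<F> (Qh (psi m)) k)\<^sup>2)) < \<infinity>"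
        using hs by (simp add: L20_norm_sq_def)
      have "integrable M (\<lambda>\<omega>. Hdot_norm lam ?s (W \<omega>) powr 2)"
        using noise by (simp add: is_noise_def Lp_Hdot_def)
      then show "integrable M (\<lambda>\<omega>. (Hdot_norm lam ?s (W \<omega>))\<^sup>2)"
        using WH Hdot_norm_nonneg
        by (subst Bochner_Integration.integrable_cong[OF refl, of M _ "\<lambda>\<omega>. Hdot_norm lam ?s (W \<omega>) powr 2"])
          (auto simp: powr_numeral)
      show "(\<lambda>N. \<integral>\<^sup>+\<omega>. ennreal ((Hdot_norm lam ?s
          (\<lambda>k. (\<Sum>m<N. \<F> (Qh (psi m)) k * eta m \<omega>) - W \<omega> k))\<^sup>2) \<partial>M) \<longlonglongrightarrow> 0"
        using noise by (simp add: is_noise_def)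
    qed
    then have "integrable M (\<lambda>\<omega>. Hdot_norm lam \<beta> (\<F> (u \<omega>)) powr p)"
    proof (rule integrable_powr_of_linear_growth[where n = "2 * n"
          and x = "\<lambda>\<omega>. Hdot_norm lam ?s (W \<omega>)" and C = "stability_const \<beta>"
          and C' = "Hdot_norm lam \<beta> (\<F> (sol (\<lambda>k. 0)))", rotated -1])
      show "finite_measure M" by unfold_locales
      show "(\<lambda>\<omega>. Hdot_norm lam \<beta> (\<F> (u \<omega>))) \<in> borel_measurable M"
        by (rule measurable_compose[OF um Hdot_norm_measurable])
      show "(\<lambda>\<omega>. Hdot_norm lam ?s (W \<omega>)) \<in> borel_measurable M"
        by (rule measurable_compose[OF W Hdot_norm_measurable])
      show "0 \<le> p" "p \<le> real (2 * n)" using p n by auto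
      show "0 \<le> stability_const \<beta>" using stability_const_pos[of \<beta>] by simp
      show "0 \<le> Hdot_norm lam \<beta> (\<F> (sol (\<lambda>k. 0)))"
        by (intro Hdot_norm_nonneg solves_regular[OF sol_solves[OF Hdot_zero \<beta>(1)] Hdot_zero \<beta>(2)])
      fix \<omega> assume \<omega>: "\<omega> \<in> space M"
      show "0 \<le> Hdot_norm lam ?s (W \<omega>)" by (rule Hdot_norm_nonneg[OF WH[OF \<omega>]])
      show "0 \<le> Hdot_norm lam \<beta> (\<F> (u \<omega>)) \<and> Hdot_norm lam \<beta> (\<F> (u \<omega>)) \<le>
          stability_const \<beta> * Hdot_norm lam ?s (W \<omega>) + Hdot_norm lam \<beta> (\<F> (sol (\<lambda>k. 0)))"
        using Hdot_norm_nonneg[OF solves_regular[OF u[OF \<omega>] WH[OF \<omega>] \<beta>(2)]]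
          sol_linear_growth[OF WH[OF \<omega>] \<beta>] by (simp add: u_def)
    qed
    then show ?thesis using um by (simp add: Lp_Hdot_def)
  qed
  moreover have "AE \<omega> in M. AE x in lebesgue_on D. v \<omega> x = u \<omega> x"
    if v: "mild_solution M D lam phi f W v" for v
  proof -
    have vL: "v \<omega> \<in> L2 D" if "\<omega> \<in> space M" for \<omega>
      using v measurable_space[OF _ that, of v "L2_borel D"]
      by (simp add: mild_solution_def L2_borel_def space_metric_borel)
    have "AE \<omega> in M. \<F> (v \<omega>) = (\<lambda>k. A_pow lam (-1) (\<F> (\<lambda>x. f (v \<omega> x))) k + A_pow lam (-1) (W \<omega>) k)"
      using v by (simp add: mild_solution_def)
    then show ?thesis
      using AE_space
    proof eventually_elim
      case (elim \<omega>)
      then have "solves (W \<omega>) (v \<omega>)" by (simp add: solves_def drift_def vL)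
      then show ?case by (rule solves_unique[OF _ u[OF elim(2)] WH[OF elim(2)] \<beta>(1)])
    qed
  qed
  ultimately show ?thesis by blast
qed

end
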